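(* Let $\mathcal{O}(C)$ be the orbit tile (in the space of triangles) of a combinatorial type $C$. Suppose $\mathcal{O}(C)$ contains an isosceles triangle $(\theta,\theta)$ whose base angle $\theta$ is either an irrational multiple of $\pi$ or of the form $\frac{a}{b}\pi$ with $a,b\in\mathbb{Z}$, $\gcd(a,b)=1$ and $b$ even. Then $\mathcal{O}(C)$ is symmetric across the line of isosceles triangles $\{\theta_1=\theta_2\}$, i.e. $(\theta_1,\theta_2)\in\mathcal{O}(C)$ if and only if $(\theta_2,\theta_1)\in\mathcal{O}(C)$.
   Context: The set of triangles is regarded as the set of pairs $(\theta_1,\theta_2)$ with $0<\theta_1,\theta_2<\frac{\pi}{2}$; such a pair is interpreted as the triangle with angles $\theta_1,\theta_2$ and $\pi-\theta_1-\theta_2$. Its edges are labeled $1,2,3$, opposite the angles $\theta_1,\theta_2,\pi-\theta_1-\theta_2$ respectively; edge $3$, joining the vertices with angles $\theta_1$ and $\theta_2$, is called the base. The line of isosceles triangles is $\theta_1=\theta_2$. A periodic trajectory on a convex polygon $P$ is a closed billiard path $f:[0,1]\to P$: it moves in straight lines at constant speed, its derivative is reflected across an edge whenever it strikes that edge, and it closes up after time $1$ in both position and direction. Its combinatorial type is the sequence $\sigma_1\cdots\sigma_k$ of edges it strikes, in order. Two combinatorial types are considered equivalent if they are identical or one is obtained by reversing the other (traversing the trajectory backwards). Trajectories on triangles are required to originate from the base. Given a combinatorial type $C$, its orbit tile $\mathcal{O}(C)$ is the set of triangles which admit a periodic trajectory with combinatorial type $C$ (up to the equivalence identifying a combinatorial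 type with the one obtained by reversing it, i.e. by traversing the trajectory backwards). *)

theory Defs
  imports "HOL-Analysis.Analysis"
begin

definition triangles :: "(real \<times> real) set" where
  "triangles = {0<..<pi/2} \<times> {0<..<pi/2}"

text \<open>Admitting a billiard path is invariant under similarity, so the triangle with angles
  \<open>\<theta>\<^sub>1\<close>, \<open>\<theta>\<^sub>2\<close>, \<open>\<pi> - \<theta>\<^sub>1 - \<theta>\<^sub>2\<close> is placed in the plane with its base equal to the segment
  from 0 to 1, the angle \<open>\<theta>\<^sub>1\<close> at 0 and the angle \<open>\<theta>\<^sub>2\<close> at 1. By the law of sines the side
  from 0 to the third vertex then has length \<open>sin \<theta>\<^sub>2 / sin (\<theta>\<^sub>1 + \<theta>\<^sub>2)\<close>.\<close>

definition apex :: "real \<times> real \<Rightarrow> complex" where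
  "apex T = (case T of (\<theta>1, \<theta>2) \<Rightarrow> of_real (sin \<theta>2 / sin (\<theta>1 + \<theta>2)) * cis \<theta>1)"

definition region :: "real \<times> real \<Rightarrow> complex set" where
  "region T = convex hull {0, 1, apex T}"

datatype edge = Edge1 | Edge2 | Edge3

fun edge_ends :: "real \<times> real \<Rightarrow> edge \<Rightarrow> complex \<times> complex" where
  "edge_ends T Edge1 = (1, apex T)"
| "edge_ends T Edge2 = (0, apex T)"
| "edge_ends T Edge3 = (0, 1)"

definition edge_interior :: "real \<times> real \<Rightarrow> edge \<Rightarrow> complex set" where
  "edge_interior T e = (case edge_ends T e of (a, b) \<Rightarrow> open_segment a b)"

text \<open>For \<open>u \<noteq> 0\<close>, the map \<open>z \<mapsto> (u / cnj u) * cnj z\<close> is the orthogonal reflection in the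
  real line spanned by \<open>u\<close>.\<close>

definition reflect_dir :: "real \<times> real \<Rightarrow> edge \<Rightarrow> complex \<Rightarrow> complex" where
  "reflect_dir T e v = (case edge_ends T e of (a, b) \<Rightarrow> (b - a) / cnj (b - a) * cnj v)"

text \<open>The path \<open>f\<close>, parametrised by \<open>[0,1]\<close>, strikes the edges \<open>C ! 0, \<dots>, C ! (k - 1)\<close> at the
  times \<open>t 0 = 0 < t 1 < \<dots> < t (k - 1) < 1\<close>, and has constant velocity \<open>v i\<close> on
  \<open>[t i, t (i + 1)]\<close>, where \<open>t k = 1\<close>. Since the path is closed, the times 0 and 1 are one and
  the same strike, recorded once, as \<open>C ! 0\<close>; the case \<open>i + 1 = k\<close> of the reflection
  law below is the closing condition on the direction. Reflections preserve the norm, so the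
  speed is constant along the path. A path that reaches a vertex has no combinatorial type.\<close>

definition periodic_trajectory ::
  "real \<times> real \<Rightarrow> (real \<Rightarrow> complex) \<Rightarrow> edge list \<Rightarrow> bool" where
  "periodic_trajectory T f C \<longleftrightarrow>
     (let k = length C in k > 0 \<and>
       (\<exists>(t :: nat \<Rightarrow> real) (v :: nat \<Rightarrow> complex).
          t 0 = 0 \<and> t k = 1 \<and> f 1 = f 0 \<and>
          (\<forall>i<k. t i < t (Suc i) \<and>
                 f (t i) \<in> edge_interior T (C ! i) \<and>
                 v i \<noteq> 0 \<and>
                 (\<forall>s\<in>{t i..t (Suc i)}. f s = f (t i) + (s - t i) *\<^sub>R v i) \<and>
                 (\<forall>s\<in>{t i<..<t (Suc i)}. f s \<in> interior (region T)) \<and>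
                 v (Suc i mod k) = reflect_dir T (C ! (Suc i mod k)) (v i))))"

definition from_base :: "real \<times> real \<Rightarrow> (real \<Rightarrow> complex) \<Rightarrow> bool" where
  "from_base T f \<longleftrightarrow> f 0 \<in> edge_interior T Edge3"

text \<open>If \<open>f\<close> has type \<open>e # es\<close>, where \<open>e\<close> is struck at time 0, then the backward path
  \<open>\<lambda>s. f (1 - s)\<close> also starts at \<open>e\<close> and has type \<open>e # rev es\<close>: the cyclic word is reversed
  with its starting edge kept first.\<close>

fun reverse_type :: "edge list \<Rightarrow> edge list" where
  "reverse_type [] = []"
| "reverse_type (e # es) = e # rev es"

definition equivalent_types :: "edge list \<Rightarrow> edge list \<Rightarrow> bool" where
  "equivalent_types C D \<longleftrightarrow> D = C \<or> D = reverse_type C"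

definition orbit_tile :: "edge list \<Rightarrow> (real \<times> real) set" where
  "orbit_tile C = {T \<in> triangles. \<exists>f D. from_base T f \<and> periodic_trajectory T f D \<and>
     equivalent_types C D}"

end

theory Submission
  imports Defs
begin

text \<open>Unfold the isosceles triangle across its base only. The triangle and its mirror image form a
  rhombus, and a billiard path becomes a straight line that enters and leaves copies of this
  rhombus through their four sides. The copies can be numbered by integers such that crossing a
  side changes the number by one: copy \<open>n\<close> and copy \<open>n + 1\<close> differ by a rotation
  by \<open>2 * \<theta>\<close>. In the frame of the rhombus the direction of the path depends on \<open>n\<close>
  alone, so the path is recorded by the numbers \<open>n\<close> together with the signed distances \<open>x\<close> of the
  line from the centre of the rhombus. The half turn of the rhombus, combined with traversing the
  line backwards, maps \<open>(n, x)\<close> to \<open>(n, -x)\<close>; on words it is reversal together with the exchange of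
  the edges 1 and 2.

  The finitely many lines of a closed path in one copy are ordered by \<open>x\<close>, and this order together
  with the numbers of lines that cross each side determines where a line goes next. Let the flux
  be the number of crossings from copy \<open>n\<close> to copy \<open>n + 1\<close> minus the number of crossings back; it
  is independent of \<open>n\<close>. If the flux is zero, then the path and its image under the half turn cross
  each side equally often. Lines of the same rank, counted from the left in the path and in its
  image, then have the same itinerary (\<open>same_rank_cross\<close>). So the word of the path is, up to cyclic
  rotation, its own reversal with 1 and 2 exchanged (\<open>word_palindromic\<close>).

  The flux is zero when \<open>\<theta>\<close> is an irrational multiple of \<open>\<pi>\<close>, because the direction must return
  and so the numbers \<open>n\<close> do. When \<open>\<theta> = a * \<pi> / b\<close> with \<open>b = 2 * N\<close>, the number can grow by a multiple
  of \<open>b\<close> over a period. Rotating by \<open>N\<close> copies reverses the direction in the rhombus, which amounts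
  to exchanging 1 and 2 without reversal. If the path does not return shifted by \<open>N\<close> modulo \<open>b\<close>, then
  the path and its shift together have twice its flux. But modulo the half turn, the chain of
  \<open>N\<close> rhombi is an annulus, in which a simple closed curve winds around at most once: a flux is at
  most one in absolute value (\<open>flux_le_1\<close>). So either the flux is zero, or the path does return
  shifted by \<open>N\<close> modulo \<open>b\<close> and its word is a cyclic rotation of the word with 1 and 2 exchanged
  (\<open>shifted_word\<close>).

  In all cases the word with 1 and 2 exchanged is a rotation of the word or of its reversal. Now
  the mirror image of a triangle exchanges the base angles and the edges 1 and 2 of a path, and
  the starting point of a closed path can be moved along it.\<close>

section \<open>Ordered lines in a chain of cells\<close>

text \<open>The half turn about the centre of every cell.\<close>

definition flip :: "(int \<times> real) set \<Rightarrow> (int \<times> real) set" where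
  "flip A = {(n, x). (n, -x) \<in> A}"

definition fib :: "(int \<times> real) set \<Rightarrow> int \<Rightarrow> real set" where
  "fib A n = {x. (n, x) \<in> A}"

definition left_count :: "(int \<times> real) set \<Rightarrow> int \<Rightarrow> real \<Rightarrow> nat" where
  "left_count A n q = card {x \<in> fib A n. x < q}"

lemma flip_flip [simp]: "flip (flip A) = A"
  by (auto simp: flip_def)

lemma fib_flip: "fib (flip A) n = uminus ` fib A n"
  by (force simp: flip_def fib_def image_iff)

lemma mem_fib [simp]: "x \<in> fib A n \<longleftrightarrow> (n, x) \<in> A"
  by (simp add: fib_def)

lemma mem_flip [simp]: "(n, x) \<in> flip A \<longleftrightarrow> (n, -x) \<in> A"
  by (simp add: flip_def)

text \<open>A line at position \<open>x\<close> in cell \<open>n\<close> moves to cell \<open>n + 1\<close> or \<open>n - 1\<close>, according to the side of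
  the threshold \<open>F n\<close> on which it lies; \<open>lft d n\<close> says that the lines moving in direction \<open>d\<close> are
  those on the left. The move translates the line by \<open>T d n\<close>. The amount is the same for
  both directions because opposite sides of a cell are parallel: the half turn maps a crossing of one
  side to a backward crossing of the opposite side.\<close>

locale strip_flow =
  fixes lft :: "int \<Rightarrow> int \<Rightarrow> bool" and F :: "int \<Rightarrow> real" and T :: "int \<Rightarrow> int \<Rightarrow> real"
  assumes lft_neg: "d \<in> {1, -1} \<Longrightarrow> lft (-d) n \<longleftrightarrow> \<not> lft d n"
    and T_sym: "d \<in> {1, -1} \<Longrightarrow> T (-d) (n + d) = T d n"
begin

definition goes :: "int \<Rightarrow> int \<Rightarrow> real \<Rightarrow> bool" where
  "goes d n x \<longleftrightarrow> (if lft d n then x < F n else F n < x)"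

text \<open>The second condition says that the backward line, turned by the half turn, is sent
  back to where it came from.\<close>

definition crosses :: "int \<Rightarrow> int \<Rightarrow> real \<Rightarrow> bool" where
  "crosses d n x \<longleftrightarrow> goes d n x \<and> goes (-d) (n + d) (-(x + T d n))"

definition follows :: "(int \<times> real) set \<Rightarrow> bool" where
  "follows A \<longleftrightarrow> (\<forall>n x. (n, x) \<in> A \<longrightarrow>
     (\<exists>d\<in>{1, -1}. crosses d n x \<and> (n + d, x + T d n) \<in> A))"

definition strands :: "(int \<times> real) set \<Rightarrow> bool" where
  "strands A \<longleftrightarrow> (\<forall>n. finite (fib A n)) \<and> follows A \<and> follows (flip A)"

definition exits :: "(int \<times> real) set \<Rightarrow> int \<Rightarrow> int \<Rightarrow> real set" where
  "exits A d n = {x \<in> fib A n. goes d n x}"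

definition flux :: "(int \<times> real) set \<Rightarrow> int \<Rightarrow> int" where
  "flux A n = int (card (exits A 1 n)) - int (card (exits A (-1) (n + 1)))"

lemma goes_excl: "d \<in> {1, -1} \<Longrightarrow> goes d n x \<Longrightarrow> \<not> goes (-d) n x"
  using lft_neg[of d n] by (auto simp: goes_def split: if_splits)

lemma goes_unique: "d \<in> {1, -1} \<Longrightarrow> d' \<in> {1, -1} \<Longrightarrow> goes d n x \<Longrightarrow> goes d' n x \<Longrightarrow> d = d'"
  using goes_excl[of d n x] by auto

lemma strands_finite: "strands A \<Longrightarrow> finite (fib A n)"
  by (simp add: strands_def)

lemma finite_exits: "strands A \<Longrightarrow> finite (exits A d n)"
  by (rule finite_subset[OF _ strands_finite]) (auto simp: exits_def)

lemma strands_flip: "strands A \<Longrightarrow> strands (flip A)"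
  by (simp add: strands_def fib_flip)

lemma strands_step:
  assumes "strands A" "d \<in> {1, -1}" "(n, x) \<in> A" "goes d n x"
  shows "crosses d n x" "(n + d, x + T d n) \<in> A"
proof -
  obtain d' where d': "d' \<in> {1, -1}" "crosses d' n x" "(n + d', x + T d' n) \<in> A"
    using assms unfolding strands_def follows_def by blast
  have "d' = d" using goes_unique d' assms by (meson crosses_def)
  then show "crosses d n x" "(n + d, x + T d n) \<in> A" using d' by auto
qed

lemma strands_goes:
  assumes "strands A" "(n, x) \<in> A" "d \<in> {1, -1}"
  shows "goes (-d) n x \<longleftrightarrow> \<not> goes d n x"
proof -
  obtain d' where d': "d' \<in> {1, -1}" "crosses d' n x"
    using assms unfolding strands_def follows_def by blast
  then show ?thesis using goes_excl[of d n x] assms(3) by (auto simp: crosses_def)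
qed

lemma strands_back:
  assumes "strands A" "d \<in> {1, -1}" "(n, x) \<in> A" "goes d n (-x)"
  shows "crosses (-d) (n + d) (x - T d n)" "(n + d, x - T d n) \<in> A" "T (-d) (n + d) = T d n"
proof -
  have *: "crosses d n (-x)" "(n + d, - x + T d n) \<in> flip A"
    using strands_step[OF strands_flip[OF assms(1)] assms(2), of n "-x"] assms by auto
  show "(n + d, x - T d n) \<in> A" using * by auto
  show t: "T (-d) (n + d) = T d n" using T_sym assms by auto
  show "crosses (-d) (n + d) (x - T d n)" using * t by (auto simp: crosses_def algebra_simps)
qed

text \<open>The half turn makes a crossing of one side of a cell into a backward crossing of the opposite
  side.\<close>

lemma card_exits_flip:
  assumes "strands A" "d \<in> {1, -1}"
  shows "card (exits (flip A) (-d) (n + d)) = card (exits A d n)"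
proof -
  have "bij_betw (\<lambda>x. - (x + T d n)) (exits A d n) (exits (flip A) (-d) (n + d))"
  proof (rule bij_betw_byWitness[where f' = "\<lambda>y. -y - T d n"])
    show "(\<lambda>x. - (x + T d n)) ` exits A d n \<subseteq> exits (flip A) (-d) (n + d)"
      proof clarify
      fix x assume "x \<in> exits A d n"
      then have "(n, x) \<in> A" "goes d n x" by (auto simp: exits_def)
      from strands_step[OF assms this]
      show "- (x + T d n) \<in> exits (flip A) (-d) (n + d)" by (simp add: exits_def crosses_def add.commute)
    qed
    show "(\<lambda>y. - y - T d n) ` exits (flip A) (- d) (n + d) \<subseteq> exits A d n"
    proof clarify
      fix y assume y: "y \<in> exits (flip A) (-d) (n + d)"
      have d: "-d \<in> {1,-1}" using assms by auto
      have t: "T (-d) (n + d) = T d n" using T_sym assms by auto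
      have "(n + d, -y) \<in> A" "goes (-d) (n + d) (- (-y))" using y by (auto simp: exits_def)
      from strands_back[OF assms(1) d this] t
      show "- y - T d n \<in> exits A d n" by (auto simp: exits_def crosses_def)
    qed
  qed auto
  then show ?thesis by (simp add: bij_betw_same_card)
qed

lemma card_fib_split:
  assumes "strands A" "d \<in> {1, -1}"
  shows "card (fib A n) = card (exits A d n) + card (exits A (-d) n)"
proof -
  have "fib A n = exits A d n \<union> exits A (-d) n"
    using strands_goes[OF assms(1) _ assms(2)] by (auto simp: exits_def)
  moreover have "exits A d n \<inter> exits A (-d) n = {}"
    using goes_excl[OF assms(2)] by (auto simp: exits_def)
  ultimately show ?thesis using finite_exits[OF assms(1)] by (metis card_Un_disjoint)
qed

lemma card_fib_flip: "card (fib (flip A) n) = card (fib A n)"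
  by (simp add: fib_flip card_image)

text \<open>Each line that enters a cell also leaves it.\<close>

lemma flux_const:
  assumes "strands A"
  shows "flux A n = flux A 0"
proof -
  have step: "flux A (m + 1) = flux A m" for m
  proof -
    have "card (fib A (m+1)) = card (exits A 1 (m+1)) + card (exits A (-1) (m+1))"
      using card_fib_split[OF assms, of 1] by simp
    moreover have "card (fib (flip A) (m+1)) = card (exits (flip A) 1 (m+1)) + card (exits (flip A) (-1) (m+1))"
      using card_fib_split[OF strands_flip[OF assms], of 1] by simp
    moreover have "card (exits (flip A) (-1) (m+1)) = card (exits A 1 m)"
      using card_exits_flip[OF assms, of 1 m] by simp
    moreover have "card (exits (flip A) 1 (m+1)) = card (exits A (-1) (m+2))"
      using card_exits_flip[OF assms, of "-1" "m+2"] by (simp add: add.commute)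
    ultimately show ?thesis by (simp add: flux_def card_fib_flip add.assoc)
  qed
  show ?thesis
  proof (induction n rule: int_induct[where k = 0])
    case (step2 i) then show ?case using step[of "i - 1"] by simp
  qed (simp_all add: step)
qed

text \<open>The lines to the left of \<open>q\<close> that take the same exit keep their order. The others are to
  the left of \<open>q\<close> all at once or not at all, both before the crossing and after it. The
  point \<open>q\<close> is arbitrary, so that the lines of \<open>A\<close> can be counted along lines of \<open>flip A\<close>.\<close>

lemma left_count_cross:
  assumes A: "strands A" and d: "d \<in> {1, -1}" and q: "crosses d n q"
  shows "left_count A (n + d) (q + T d n) + (if lft d n then 0 else card (exits A (-d) n))
       = left_count A n q + (if lft d (n + d) then 0 else card (exits A (-d) (n + d + d)))"
proof -
  define E where "E = {x \<in> exits A d n. x < q}"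
  have finE: "finite E" using finite_exits[OF A] by (simp add: E_def)
  have d': "-d \<in> {1, -1}" using d by auto
  have gq: "goes d n q" "goes (-d) (n + d) (-(q + T d n))" using q by (auto simp: crosses_def)
  have dich: "goes d m x \<or> goes (-d) m x" if "(m, x) \<in> A" for m x
    using strands_goes[OF A that d] by auto
  have 1: "left_count A n q = card E + (if lft d n then 0 else card (exits A (-d) n))"
  proof (cases "lft d n")
    case True
    then have "{x \<in> fib A n. x < q} = E" using gq by (auto simp: E_def exits_def goes_def)
    then show ?thesis using True by (simp add: left_count_def)
  next
    case False
    then have "{x \<in> fib A n. x < q} = E \<union> exits A (-d) n"
      using gq dich[of n] lft_neg[OF d] by (fastforce simp: E_def exits_def goes_def)
    moreover have "E \<inter> exits A (-d) n = {}" using goes_excl[OF d] by (auto simp: E_def exits_def)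
    ultimately show ?thesis using False finE finite_exits[OF A]
      by (simp add: left_count_def card_Un_disjoint)
  qed
  define E' where "E' = (\<lambda>x. x + T d n) ` E"
  have cE': "card E' = card E" unfolding E'_def by (rule card_image) (auto simp: inj_on_def)
  have E'_eq: "E' = {y \<in> fib A (n+d). goes (-d) (n + d) (-y) \<and> y < q + T d n}"
  proof (intro equalityI subsetI)
    fix y assume "y \<in> E'"
    then obtain x where x: "x \<in> E" "y = x + T d n" by (auto simp: E'_def)
    then show "y \<in> {y \<in> fib A (n+d). goes (-d) (n + d) (-y) \<and> y < q + T d n}"
      using strands_step[OF A d, of n x] by (auto simp: E_def exits_def crosses_def)
  next
    fix y assume y: "y \<in> {y \<in> fib A (n+d). goes (-d) (n + d) (-y) \<and> y < q + T d n}"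
    have "T (-d) (n + d) = T d n" using T_sym[OF d] .
    with strands_back[OF A d', of "n+d" y] y have "y - T d n \<in> E"
      by (auto simp: E_def exits_def crosses_def)
    then show "y \<in> E'" unfolding E'_def by (rule rev_image_eqI) simp
  qed
  define G where "G = {y \<in> fib A (n+d). goes d (n + d) (-y)}"
  have cG: "card G = card (exits A (-d) (n + d + d))"
  proof -
    have "G = uminus ` exits (flip A) d (n+d)" by (force simp: G_def exits_def image_iff)
    then have "card G = card (exits (flip A) d (n+d))" by (simp add: card_image)
    also have "\<dots> = card (exits A (-d) (n + d + d))"
      using card_exits_flip[OF A d', of "n+d+d"] by (simp only: add_diff_cancel_right' minus_minus flip: diff_conv_add_uminus)
    finally show ?thesis .
  qed
  have finG: "finite G" 
    by (rule finite_subset[OF _ strands_finite[OF A, of "n + d"]]) (auto simp: G_def)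
  have dichf: "goes d (n+d) (-y) \<or> goes (-d) (n+d) (-y)" if "(n+d, y) \<in> A" for y
    using strands_goes[OF strands_flip[OF A] _ d, of "n+d" "-y"] that by auto
  have 2: "left_count A (n + d) (q + T d n) = card E + (if lft d (n + d) then 0 else card G)"
  proof (cases "lft d (n + d)")
    case True
    then have "{x \<in> fib A (n + d). x < q + T d n} = E'"
      using gq dichf lft_neg[OF d] by (auto simp: E'_eq goes_def)
    then show ?thesis using True cE' by (simp add: left_count_def)
  next
    case False
    then have "{x \<in> fib A (n + d). x < q + T d n} = E' \<union> G"
      using gq dichf lft_neg[OF d] by (auto simp: E'_eq G_def goes_def)
    moreover have "E' \<inter> G = {}" using goes_excl[OF d] by (auto simp: E'_eq G_def)
    moreover have "finite E'" using finE by (simp add: E'_def)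
    ultimately show ?thesis using False finG cE' by (simp add: left_count_def card_Un_disjoint)
  qed
  show ?thesis using 1 2 cG by simp
qed

lemma goes_iff_left_count:
  assumes A: "strands A" and d: "d \<in> {1, -1}" and q: "(n, q) \<in> A" and l: "lft d n"
  shows "goes d n q \<longleftrightarrow> left_count A n q < card (exits A d n)"
proof
  assume g: "goes d n q"
  have "{x \<in> fib A n. x < q} \<subset> exits A d n"
    using g l q by (auto simp: exits_def goes_def)
  then show "left_count A n q < card (exits A d n)"
    unfolding left_count_def by (rule psubset_card_mono[OF finite_exits[OF A]])
next
  assume r: "left_count A n q < card (exits A d n)"
  show "goes d n q"
  proof (rule ccontr)
    assume "\<not> goes d n q"
    then have "exits A d n \<subseteq> {x \<in> fib A n. x < q}"
      using l by (auto simp: exits_def goes_def)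
    then have "card (exits A d n) \<le> left_count A n q"
      unfolding left_count_def
      by (rule card_mono[rotated]) (rule finite_subset[OF _ strands_finite[OF A, of n]], auto)
    then show False using r by simp
  qed
qed

text \<open>The lines that take the left exit are those of the lowest ranks, and
  their number decides how many ranks that is. So two sets of lines with equally many crossings of
  each side behave alike.\<close>

lemma same_rank_goes:
  assumes A: "strands A" and B: "strands B" and d: "d \<in> {1, -1}"
    and eq: "\<And>d n. d \<in> {1, -1} \<Longrightarrow> card (exits A d n) = card (exits B d n)"
    and q: "(n, q) \<in> A" and r: "(n, r) \<in> B" and rk: "left_count A n q = left_count B n r"
  shows "goes d n q \<longleftrightarrow> goes d n r"
proof (cases "lft d n")
  case True
  then show ?thesis using goes_iff_left_count[OF A d q] goes_iff_left_count[OF B d r] eq[OF d] rk by simp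
next
  case False
  have d': "-d \<in> {1, -1}" using d by auto
  have "goes (-d) n q \<longleftrightarrow> goes (-d) n r"
    using goes_iff_left_count[OF A d' q] goes_iff_left_count[OF B d' r] eq[OF d'] rk False lft_neg[OF d] by simp
  then show ?thesis using strands_goes[OF A q d] strands_goes[OF B r d] by simp
qed

lemma same_rank_cross:
  assumes A: "strands A" and B: "strands B" and d: "d \<in> {1, -1}"
    and eq: "\<And>d n. d \<in> {1, -1} \<Longrightarrow> card (exits A d n) = card (exits B d n)"
    and q: "(n, q) \<in> A" and r: "(n, r) \<in> B" and rk: "left_count A n q = left_count B n r"
    and g: "goes d n q"
  shows "left_count A (n + d) (q + T d n) = left_count B (n + d) (r + T d n)"
proof -
  have d': "-d \<in> {1, -1}" using d by auto
  have g': "goes d n r" using same_rank_goes[OF A B d eq q r rk] g by blast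
  show ?thesis
    using left_count_cross[OF A d strands_step(1)[OF A d q g]]
      left_count_cross[OF B d strands_step(1)[OF B d r g']] rk eq[OF d'] by (simp split: if_splits)
qed

lemma card_exits_flip_flux:
  assumes A: "strands A"
  shows "int (card (exits (flip A) 1 n)) = int (card (exits A 1 n)) - flux A 0"
    "int (card (exits (flip A) (-1) n)) = int (card (exits A (-1) n)) + flux A 0"
  using card_exits_flip[OF A, of "-1" "n+1"] card_exits_flip[OF A, of "1" "n-1"]
    flux_const[OF A, of n] flux_const[OF A, of "n-1"] by (auto simp: flux_def)

lemma zero_flux_exits:
  assumes "strands A" "flux A 0 = 0" "d \<in> {1, -1}"
  shows "card (exits A d n) = card (exits (flip A) d n)"
  using card_exits_flip_flux[OF assms(1)] assms(2,3) by auto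

text \<open>In the quotient by the half turn, this is the number of times, counted with signs, that a curve
  from a fixed boundary component to the point \<open>q\<close> crosses the path; so it is unchanged when \<open>q\<close>
  moves without meeting the path. The first two terms belong to the curve that runs in the cell from
  its left corner to \<open>q\<close>: there, crossings of the image of the path count negatively as the half turn
  reverses the orientation. The left corner lies on one boundary component or on the other according to
  \<open>lft 1 n\<close>, and a curve between the two components crosses the path as often as the flux says.\<close>

definition potential :: "(int \<times> real) set \<Rightarrow> int \<Rightarrow> real \<Rightarrow> int" where
  "potential A n q = int (left_count A n q) - int (left_count (flip A) n q) + (if lft 1 n then 0 else flux A 0)"

lemma potential_cross:
  assumes A: "strands A" and d: "d \<in> {1, -1}" and q: "crosses d n q"
  shows "potential A (n + d) (q + T d n) = potential A n q"
proof -
  note 1 = left_count_cross[OF A d q] and 2 = left_count_cross[OF strands_flip[OF A] d q]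
  note 3 = card_exits_flip_flux[OF A]
  show ?thesis
  proof (cases "d = 1")
    case True
    then show ?thesis using 1 2 3(2)[of n] 3(2)[of "n+2"]
      by (auto simp: potential_def add.assoc split: if_splits)
  next
    case False
    then have "d = -1" using d by auto
    then show ?thesis using 1 2 3(1)[of n] 3(1)[of "n-2"] lft_neg[of 1 n] lft_neg[of 1 "n-1"]
      by (auto simp: potential_def split: if_splits)
  qed
qed

text \<open>The half turn interchanges the left and the right side of \<open>q\<close>, and across a line of the path the
  potential grows by one, unless the image of the path runs along the same line.\<close>

lemma potential_flip:
  assumes A: "strands A" and q: "(n, q) \<in> A"
  shows "potential A n (-q) = potential A n q + 1 - of_bool ((n, -q) \<in> A)"
proof -
  have fin: "finite (fib A n)" using strands_finite[OF A] .
  have a: "card {x \<in> fib A n. x \<le> y} = left_count A n y + of_bool ((n, y) \<in> A)" for y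
  proof -
    have "{x \<in> fib A n. x \<le> y} = (if (n,y) \<in> A then insert y {x \<in> fib A n. x < y} else {x \<in> fib A n. x < y})"
      by (auto simp: less_le)
    moreover have "finite {x \<in> fib A n. x < y}"
      by (rule finite_subset[OF _ fin]) auto
    ultimately show ?thesis by (simp add: left_count_def)
  qed
  have b: "left_count (flip A) n y = card {x \<in> fib A n. - y < x}" for y
  proof -
    have "{x \<in> fib (flip A) n. x < y} = uminus ` {x \<in> fib A n. - y < x}"
      by (force simp: image_iff)
    then show ?thesis by (simp add: left_count_def card_image)
  qed
  have c: "card (fib A n) = card {x \<in> fib A n. x \<le> y} + card {x \<in> fib A n. y < x}" for y
  proof -
    have "fib A n = {x \<in> fib A n. x \<le> y} \<union> {x \<in> fib A n. y < x}" by auto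
    moreover have "{x \<in> fib A n. x \<le> y} \<inter> {x \<in> fib A n. y < x} = {}" by auto
    ultimately show ?thesis using fin by (metis (no_types, lifting) card_Un_disjoint finite_Un)
  qed
  show ?thesis using a[of q] a[of "-q"] b[of q] b[of "-q"] c[of q] c[of "-q"] q
    by (cases "(n, -q) \<in> A") (simp_all add: potential_def)
qed

lemma potential_first:
  assumes A: "strands A" and g: "goes 1 n q"
    and first: "\<And>y. y \<in> exits A 1 n \<union> exits (flip A) 1 n \<Longrightarrow> q \<le> y"
  shows "potential A n q = 0"
proof -
  have R: "int (left_count B n q) = (if lft 1 n then 0 else int (card (exits B (-1) n)))"
    if B: "strands B" and first: "\<And>y. y \<in> exits B 1 n \<Longrightarrow> q \<le> y" for B
  proof -
    have "{x \<in> fib B n. x < q} = (if lft 1 n then {} else exits B (-1) n)"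
      using first g strands_goes[OF B, of n _ 1] lft_neg[of 1 n]
      by (fastforce simp: exits_def goes_def not_less split: if_splits)
    then show ?thesis by (simp add: left_count_def)
  qed
  show ?thesis using R[OF A] R[OF strands_flip[OF A]] first card_exits_flip_flux(2)[OF A, of n]
    by (simp add: potential_def)
qed

lemma potential_last:
  assumes A: "strands A" and g: "goes 1 n q"
    and last: "\<And>y. y \<in> exits A 1 n \<union> exits (flip A) 1 n \<Longrightarrow> y \<le> q"
  shows "potential A n q = flux A 0 - of_bool ((n, q) \<in> A) + of_bool ((n, -q) \<in> A)"
proof -
  have R: "int (left_count B n q) = int (card (exits B 1 n)) - of_bool ((n, q) \<in> B)
     + (if lft 1 n then 0 else int (card (exits B (-1) n)))"
    if B: "strands B" and last: "\<And>y. y \<in> exits B 1 n \<Longrightarrow> y \<le> q" for B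
  proof -
    have eq: "{x \<in> fib B n. x < q} = (exits B 1 n - {q}) \<union> (if lft 1 n then {} else exits B (-1) n)"
      using last g strands_goes[OF B, of n _ 1] lft_neg[of 1 n]
      by (fastforce simp: exits_def goes_def not_less split: if_splits)
    have disj: "(exits B 1 n - {q}) \<inter> (if lft 1 n then {} else exits B (-1) n) = {}"
      using goes_excl[of 1 n] by (auto simp: exits_def)
    have "left_count B n q = card (exits B 1 n - {q}) + card (if lft 1 n then {} else exits B (-1) n)"
      unfolding left_count_def eq using disj finite_exits[OF B] by (intro card_Un_disjoint) auto
    moreover have "int (card (exits B 1 n - {q})) = int (card (exits B 1 n)) - of_bool ((n, q) \<in> B)"
    proof (cases "(n, q) \<in> B")
      case True
      then have "q \<in> exits B 1 n" using g by (simp add: exits_def)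
      then have "card (exits B 1 n) > 0" using finite_exits[OF B] card_gt_0_iff by blast
      then show ?thesis using True \<open>q \<in> _\<close> by (simp add: card_Diff_singleton)
    next
      case False
      then have "q \<notin> exits B 1 n" by (simp add: exits_def)
      then show ?thesis using False by simp
    qed
    ultimately show ?thesis by simp
  qed
  show ?thesis using R[OF A] R[OF strands_flip[OF A]] last card_exits_flip_flux[OF A, of n]
    by (simp add: potential_def)
qed

text \<open>A simple closed curve in an annulus winds around it at most once. The potential to the left of the
  curve is the same all along it, and the same holds for the potential to its right; the two
  numbers differ by one. The outermost crossings of a side see the potentials of the two boundary
  components, which are 0 and the flux. So 0 and the flux occur among two consecutive integers.\<close>

lemma flux_le_1:
  assumes A: "strands A" and c: "\<And>n q. (n, q) \<in> A \<Longrightarrow> potential A n q = c"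
    and c': "\<And>n q. (n, q) \<in> flip A \<Longrightarrow> potential A n q = c'"
  shows "\<bar>flux A 0\<bar> \<le> 1"
proof (rule ccontr)
  assume big: "\<not> ?thesis"
  define Y where "Y = exits A 1 0 \<union> exits (flip A) 1 0"
  have finY: "finite Y" using finite_exits[OF A] finite_exits[OF strands_flip[OF A]] by (simp add: Y_def)
  have "Y \<noteq> {}" using big card_exits_flip_flux(1)[OF A, of 0] by (auto simp: Y_def)
  define y0 y1 where "y0 = Min Y" and "y1 = Max Y"
  have y0: "y0 \<in> Y" "\<And>y. y \<in> Y \<Longrightarrow> y0 \<le> y" and y1: "y1 \<in> Y" "\<And>y. y \<in> Y \<Longrightarrow> y \<le> y1"
    using finY \<open>Y \<noteq> {}\<close> by (auto simp: y0_def y1_def)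
  have g: "goes 1 0 y0" "goes 1 0 y1" using y0(1) y1(1) by (auto simp: Y_def exits_def)
  have p0: "potential A 0 y0 = 0" using potential_first[OF A g(1)] y0(2) by (simp add: Y_def)
  have p1: "potential A 0 y1 = flux A 0 - of_bool ((0, y1) \<in> A) + of_bool ((0, - y1) \<in> A)"
    using potential_last[OF A g(2)] y1(2) by (simp add: Y_def)
  have m: "(0, y) \<in> A \<or> (0, -y) \<in> A" if "y \<in> Y" for y using that by (auto simp: Y_def exits_def)
  have cc: "c' = c + 1 - of_bool ((0, -y) \<in> A)" if "(0, y) \<in> A" for y
    using potential_flip[OF A that] c[OF that] c'[of 0 "-y"] that by simp
  show False
  proof (cases "c' = c")
    case True
    \<comment> \<open>Here the path coincides with its image, whose flux has the opposite sign.\<close>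
    then have "(0, -y) \<in> A" if "(0, y) \<in> A" for y using cc[OF that] by (auto split: if_splits)
    then have "(0, y) \<in> flip A \<longleftrightarrow> (0, y) \<in> A" for y by (metis mem_flip minus_minus)
    then have "exits (flip A) 1 0 = exits A 1 0" by (auto simp: exits_def)
    then show False using big card_exits_flip_flux(1)[OF A, of 0] by simp
  next
    case False
    have not_both: "\<not> ((0, y) \<in> A \<and> (0, -y) \<in> A)" for y using cc[of y] False by auto
    have "c' = c + 1"
      using m[OF y0(1)] not_both[of y0] cc[of y0] cc[of "-y0"] by auto
    then show False
      using m[OF y0(1)] m[OF y1(1)] not_both[of y1] p0 p1 c[of 0 y0] c'[of 0 y0] c[of 0 y1] c'[of 0 y1] big
      by auto
  qed
qed

end

section \<open>The chain of rhombi\<close>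

context strip_flow
begin

lemma crosses_back:
  assumes "d \<in> {1, -1}" "crosses d n x"
  shows "crosses (-d) (n + d) (-(x + T d n))" "T (-d) (n + d) = T d n"
  using assms T_sym[OF assms(1)] by (auto simp: crosses_def)

end

lemma ex_left_count:
  assumes "finite (fib A n)" "r < card (fib A n)"
  shows "\<exists>y\<in>fib A n. left_count A n y = r"
proof -
  let ?S = "fib A n"
  have "inj_on (left_count A n) ?S"
  proof (rule linorder_inj_onI')
    fix x y assume xy: "x \<in> ?S" "y \<in> ?S" "x < y"
    have "{z \<in> ?S. z < x} \<subset> {z \<in> ?S. z < y}" using xy by auto
    then have "left_count A n x < left_count A n y" unfolding left_count_def
      by (intro psubset_card_mono) (rule finite_subset[OF _ assms(1)], auto)
    then show "left_count A n x \<noteq> left_count A n y" by simp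
  qed
  moreover have "left_count A n ` ?S \<subseteq> {..<card ?S}"
  proof clarify
    fix x assume x: "x \<in> ?S"
    have "x \<notin> {z \<in> ?S. z < x}" by simp
    then have "{z \<in> ?S. z < x} \<subset> ?S" using x by blast
    then show "left_count A n x < card ?S" unfolding left_count_def
      by (rule psubset_card_mono[OF assms(1)])
  qed
  ultimately have "left_count A n ` ?S = {..<card ?S}"
    by (intro card_subset_eq) (auto simp: card_image)
  then show ?thesis using assms(2) by (metis imageE lessThan_iff)
qed

fun swap_edge :: "edge \<Rightarrow> edge" where
  "swap_edge Edge1 = Edge2" | "swap_edge Edge2 = Edge1" | "swap_edge Edge3 = Edge3"

definition sg :: "nat \<Rightarrow> real" where "sg i = (if even i then 1 else -1)"

text \<open>The change of the number of the rhombus when the path strikes an edge. The path is in the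
  upper half of the rhombus before strike \<open>i + 1\<close> if \<open>i\<close> is even, and in the lower half if \<open>i\<close> is odd. The
  upper copy of edge 2 is parallel to the lower copy of edge 1, and both lead to the next
  rhombus.\<close>

fun turn :: "nat \<Rightarrow> edge \<Rightarrow> int" where
  "turn i Edge1 = (if even i then -1 else 1)"
| "turn i Edge2 = (if even i then 1 else -1)"
| "turn i Edge3 = 0"

text \<open>The walls between the rhombi are numbered so that wall \<open>n\<close> separates \<open>n - 1\<close> from \<open>n\<close>.\<close>

definition wall :: "int \<Rightarrow> int \<Rightarrow> int" where
  "wall d n = (if d = 1 then n + 1 else n)"

text \<open>Let \<open>e m\<close> be the signed width of wall \<open>m\<close>, seen in the direction of the path; the sign tells
  which of the two copies of the wall in a rhombus is ahead of the path. Measured across the path, the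
  distance of the centre of the rhombus from the centre of a wall is half the width of the other wall, and a
  line leaves through a wall if it passes the centre of the wall at less than half its width.\<close>

definition window :: "(int \<Rightarrow> real) \<Rightarrow> int \<Rightarrow> int \<Rightarrow> real \<Rightarrow> bool" where
  "window e d n x \<longleftrightarrow>
     \<bar>x - of_int d * sgn (e (wall d n)) * e (wall (-d) n) / 2\<bar> < \<bar>e (wall d n)\<bar> / 2"

text \<open>The position of the centre of the common wall in the rhombus entered, minus its position in the
  rhombus left.\<close>

definition glide :: "(int \<Rightarrow> real) \<Rightarrow> int \<Rightarrow> int \<Rightarrow> real" where
  "glide e d n = (let m = wall d n in sgn (e m) * (e (m + 1) - e (m - 1)) / 2)"

definition left_side :: "(int \<Rightarrow> real) \<Rightarrow> int \<Rightarrow> int \<Rightarrow> bool" where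
  "left_side e d n \<longleftrightarrow> ((d = 1) = (e n * e (n + 1) \<le> 0))"

text \<open>The position of the corner between the two sides through which lines leave.\<close>

definition front :: "(int \<Rightarrow> real) \<Rightarrow> int \<Rightarrow> real" where
  "front e n = (if e n * e (n + 1) \<le> 0 then 1 else -1) * (\<bar>e (n + 1)\<bar> - \<bar>e n\<bar>) / 2"

lemma wall_back: "d \<in> {1, -1} \<Longrightarrow> wall (-d) (n + d) = wall d n"
  by (auto simp: wall_def)

locale rhombi =
  fixes e :: "int \<Rightarrow> real"
begin

sublocale strip_flow "left_side e" "front e" "glide e"
proof
  fix d n :: int assume d: "d \<in> {1, -1}"
  show "left_side e (- d) n = (\<not> left_side e d n)" using d by (auto simp: left_side_def)
  show "glide e (-d) (n + d) = glide e d n" by (simp add: glide_def wall_back[OF d])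
qed

lemma window_goes:
  assumes d: "d \<in> {1, -1}" and w: "window e d n x"
  shows "goes d n x"
proof -
  have up: "if a * b \<le> 0 then x < (\<bar>b\<bar> - \<bar>a\<bar>) / 2 else (\<bar>a\<bar> - \<bar>b\<bar>) / 2 < x"
    if "\<bar>x - sgn b * a / 2\<bar> < \<bar>b\<bar> / 2" for a b x :: real
  proof -
    have "b \<noteq> 0" using that by auto
    then consider "b > 0" | "b < 0" by linarith
    then show ?thesis
    proof cases
      case 1
      then have "\<bar>x - a / 2\<bar> < b / 2" and "a * b \<le> 0 \<longleftrightarrow> a \<le> 0"
        using that by (auto simp: mult_le_0_iff)
      then show ?thesis using 1 unfolding abs_less_iff by (cases "a \<le> 0") auto
    next
      case 2
      then have "\<bar>x + a / 2\<bar> < - b / 2" and "a * b \<le> 0 \<longleftrightarrow> a \<ge> 0"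
        using that by (auto simp: mult_le_0_iff)
      then show ?thesis using 2 unfolding abs_less_iff by (cases "a \<ge> 0") auto
    qed
  qed
  consider "d = 1" | "d = -1" using d by auto
  then show ?thesis
  proof cases
    case 1
    then have "\<bar>x - sgn (e (n + 1)) * e n / 2\<bar> < \<bar>e (n + 1)\<bar> / 2"
      using w by (simp add: window_def wall_def)
    from up[OF this] show ?thesis
      unfolding goes_def left_side_def front_def 1 by (cases "e n * e (n + 1) \<le> 0") simp_all
  next
    case 2
    then have "\<bar>x + sgn (e n) * e (n + 1) / 2\<bar> < \<bar>e n\<bar> / 2"
      using w by (simp add: window_def wall_def)
    moreover have "\<bar>- x - sgn (e n) * e (n + 1) / 2\<bar> = \<bar>x + sgn (e n) * e (n + 1) / 2\<bar>"
      using abs_minus_cancel[of "x + sgn (e n) * e (n + 1) / 2"] by simp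
    ultimately have "\<bar>- x - sgn (e n) * e (n + 1) / 2\<bar> < \<bar>e n\<bar> / 2" by simp
    from up[OF this] show ?thesis
      unfolding goes_def left_side_def front_def 2 mult.commute[of "e (n + 1)"]
      by (cases "e n * e (n + 1) \<le> 0") (simp_all add: field_simps)
  qed
qed

lemma window_crosses:
  assumes d: "d \<in> {1, -1}" and w: "window e d n x"
  shows "crosses d n x"
proof -
  have eq: "- (x + glide e d n) - of_int (-d) * sgn (e (wall (-d) (n + d))) * e (wall (- (-d)) (n + d)) / 2
     = - (x - of_int d * sgn (e (wall d n)) * e (wall (-d) n) / 2)"
    using d by (auto simp: glide_def wall_def Let_def field_simps)
  have "window e (-d) (n + d) (-(x + glide e d n))"
    unfolding window_def eq abs_minus_cancel using w wall_back[OF d] by (simp add: window_def)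
  then show ?thesis using window_goes[OF d w] window_goes[of "-d"] d by (auto simp: crosses_def)
qed

end

text \<open>The combinatorial trace of a closed path of \<open>k\<close> strikes: after strike \<open>i\<close> on edge \<open>c i\<close> it runs in
  rhombus \<open>n i\<close> at position \<open>x i\<close>. The period is doubled since an odd number of reflections
  exchanges the two halves of the rhombus.\<close>

locale folded_path = rhombi e for e :: "int \<Rightarrow> real" +
  fixes k :: nat and c :: "nat \<Rightarrow> edge" and n :: "nat \<Rightarrow> int" and x :: "nat \<Rightarrow> real" and \<delta> :: int
  assumes k: "k > 0" and c0: "c 0 = Edge3" and c_per: "c (i + k) = c i"
    and n_per: "n (i + 2 * k) = n i + \<delta>" and x_per: "x (i + 2 * k) = x i"
    and n_Suc: "n (Suc i) = n i + turn i (c (Suc i))"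
    and base: "c (Suc i) = Edge3 \<Longrightarrow> x (Suc i) = x i \<and> c (Suc (Suc i)) \<noteq> Edge3"
    and side: "c (Suc i) \<noteq> Edge3 \<Longrightarrow> d = turn i (c (Suc i)) \<Longrightarrow>
       sg i * e (wall d (n i)) > 0 \<and> window e d (n i) (x i) \<and> x (Suc i) = x i + glide e d (n i)"
begin

text \<open>All lines of the path, with the number of the rhombus read modulo \<open>B\<close>. The value \<open>B = 0\<close> leaves the
  numbers as they are.\<close>

definition track :: "int \<Rightarrow> (int \<times> real) set" where
  "track B = {(n i + B * m, x i) | i m. True}"

lemma n_per': "n (i + 2 * k * m) = n i + \<delta> * int m"
proof (induction m)
  case (Suc m)
  then show ?case using n_per[of "i + 2 * k * m"] by (simp add: algebra_simps)
qed simp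

lemma x_per': "x (i + 2 * k * m) = x i"
proof (induction m)
  case (Suc m)
  then show ?case using x_per[of "i + 2 * k * m"] by (simp add: algebra_simps)
qed simp

lemma c_per': "c (i + k * m) = c i"
proof (induction m)
  case (Suc m)
  then show ?case using c_per[of "i + k * m"] by (simp add: algebra_simps)
qed simp

lemma turn_unit: "c i \<noteq> Edge3 \<Longrightarrow> turn j (c i) \<in> {1, -1}"
  by (cases "c i") auto

lemma side':
  assumes "c (Suc i) \<noteq> Edge3"
  shows "crosses (turn i (c (Suc i))) (n i) (x i)"
    and "x (Suc i) = x i + glide e (turn i (c (Suc i))) (n i)"
    and "sg i * e (wall (turn i (c (Suc i))) (n i)) > 0"
  using side[OF assms refl] window_crosses[OF turn_unit[OF assms]] by auto

text \<open>A line crosses the base of the triangle, that is a diagonal of the rhombus, at most once before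
  it leaves the rhombus. It does so exactly if its segment starts in the half of the rhombus that
  does not contain the side through which it leaves.\<close>

lemma exit_segment:
  obtains d j where "d \<in> {1, -1}" "crosses d (n i) (x i)" "n j = n i + d" "x j = x i + glide e d (n i)"
    "c (Suc i) \<noteq> Edge3 \<Longrightarrow> d = turn i (c (Suc i)) \<and> sg i * e (wall d (n i)) > 0"
    "c (Suc i) = Edge3 \<Longrightarrow> sg i * e (wall d (n i)) < 0"
proof (cases "c (Suc i) = Edge3")
  case False
  show ?thesis
    by (rule that[OF turn_unit[OF False] side'(1)[OF False] n_Suc side'(2)[OF False]])
      (use False side'(3)[OF False] in auto)
next
  case True
  have b: "n (Suc i) = n i" "x (Suc i) = x i" "c (Suc (Suc i)) \<noteq> Edge3"
    using base[OF True] n_Suc[of i] True by auto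
  note s = side'[OF b(3)]
  show ?thesis
    by (rule that[OF turn_unit[OF b(3)], of "Suc i" "Suc (Suc i)"])
      (use True b s n_Suc[of "Suc i"] in \<open>auto simp: sg_def split: if_splits\<close>)
qed

lemma entry_segment:
  assumes "i \<ge> 2"
  obtains d j where "d \<in> {1, -1}" "crosses d (n i) (- x i)" "n j = n i + d" "- x j = - x i + glide e d (n i)"
    "c i \<noteq> Edge3 \<Longrightarrow> d = - turn (i - 1) (c i) \<and> sg (i - 1) * e (wall d (n i)) > 0"
    "c i = Edge3 \<Longrightarrow> sg (i - 1) * e (wall d (n i)) < 0"
proof -
  have enter: "- turn h (c (Suc h)) \<in> {1, -1} \<and> crosses (- turn h (c (Suc h))) (n (Suc h)) (- x (Suc h))
     \<and> n h = n (Suc h) + - turn h (c (Suc h)) \<and> - x h = - x (Suc h) + glide e (- turn h (c (Suc h))) (n (Suc h))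
     \<and> sg h * e (wall (- turn h (c (Suc h))) (n (Suc h))) > 0"
    if h: "c (Suc h) \<noteq> Edge3" for h
    using turn_unit[OF h, of h] side'[OF h] n_Suc[of h] crosses_back[OF turn_unit[OF h] side'(1)[OF h]]
      wall_back[OF turn_unit[OF h, of h], of "n h"] by auto
  obtain h where h: "i = Suc (Suc h)" using assms by (metis add_2_eq_Suc le_Suc_ex)
  show ?thesis
  proof (cases "c i = Edge3")
    case False
    have "c (Suc (Suc h)) \<noteq> Edge3" using False h by simp
    from enter[OF this] False h show ?thesis by (intro that[of _ "Suc h"]) auto
  next
    case True
    have b: "n i = n (Suc h)" "x i = x (Suc h)" "c (Suc h) \<noteq> Edge3"
      using base[of "Suc h"] base[of h] n_Suc[of "Suc h"] True h by auto
    from enter[OF b(3)] show ?thesis using b(1,2) True h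
      by (intro that[of _ h]) (auto simp: sg_def split: if_splits)
  qed
qed

end

text \<open>A shift by \<open>B\<close> may reverse the direction of the path in the rhombus. This changes the sign of all widths,
  but none of the conditions on positions.\<close>

locale folded_period = folded_path +
  fixes B :: int and \<epsilon> :: real
  assumes B: "B dvd \<delta>" and eps: "\<epsilon> \<in> {1, -1}" and e_shift: "e (m + B) = \<epsilon> * e m"
begin

lemma e_shift': "\<exists>\<epsilon>'\<in>{1,-1}. \<forall>j. e (j + B * m) = \<epsilon>' * e j"
proof (induction m rule: int_induct[where k = 0])
  case base
  then show ?case by (auto intro: bexI[of _ 1])
next
  case (step1 i)
  then obtain t where t: "t \<in> {1,-1}" "\<And>j. e (j + B * i) = t * e j" by blast
  have "e (j + B * (i + 1)) = (\<epsilon> * t) * e j" for j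
  proof -
    have "j + B * (i + 1) = j + B * i + B" by (simp add: algebra_simps)
    then show ?thesis using e_shift[of "j + B * i"] t(2)[of j] by (simp only: mult.assoc)
  qed
  then show ?case using t(1) eps by (intro bexI[of _ "\<epsilon> * t"]) auto
next
  case (step2 i)
  then obtain t where t: "t \<in> {1,-1}" "\<And>j. e (j + B * i) = t * e j" by blast
  have "e (j + B * (i - 1)) = (\<epsilon> * t) * e j" for j
    proof -
    have "j + B * (i - 1) + B = j + B * i" by (simp add: algebra_simps)
    then have "t * e j = \<epsilon> * e (j + B * (i - 1))"
      using e_shift[of "j + B * (i - 1)"] t(2)[of j] by metis
    then show ?thesis using eps by auto
  qed
  then show ?case using t(1) eps by (intro bexI[of _ "\<epsilon> * t"]) auto
qed

lemma shift_inv: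
  "left_side e d (j + B * m) = left_side e d j" "front e (j + B * m) = front e j"
  "glide e d (j + B * m) = glide e d j" "goes d (j + B * m) q = goes d j q"
  "crosses d (j + B * m) q = crosses d j q"
proof -
  obtain t where t: "t \<in> {1,-1}" "\<And>j. e (j + B * m) = t * e j" using e_shift' by blast
  have t': "e (j + B * m + 1) = t * e (j + 1)" for j using t(2)[of "j + 1"] by (simp add: algebra_simps)
  have t'': "e (j + B * m - 1) = t * e (j - 1)" for j
    using t(2)[of "j - 1"] by (simp add: algebra_simps)
  show 1: "left_side e d (j + B * m) = left_side e d j" for d j using t by (auto simp: left_side_def t')
  show 2: "front e (j + B * m) = front e j" for j using t by (auto simp: front_def t')
  have w: "wall d (j + B * m) = wall d j + B * m" for d j by (simp add: wall_def)
  show 3: "glide e d (j + B * m) = glide e d j" for d j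
    using t(1) unfolding glide_def Let_def w t(2) t' t'' sgn_mult by auto
  show 4: "goes d (j + B * m) q = goes d j q" for d j q by (simp add: goes_def 1 2)
  show "crosses d (j + B * m) q = crosses d j q"
    using 4[of "-d" "j + d"] by (simp add: crosses_def 3 4 algebra_simps)
qed

lemma track_memI: "(n i + B * m, x i) \<in> track B"
  by (auto simp: track_def)

lemma track_shift: "(j + B * m, q) \<in> track B \<longleftrightarrow> (j, q) \<in> track B"
proof
  assume "(j, q) \<in> track B"
  then obtain i l where "j = n i + B * l" "q = x i" by (auto simp: track_def)
  then show "(j + B * m, q) \<in> track B" using track_memI[of i "l + m"] by (simp add: algebra_simps)
next
  assume "(j + B * m, q) \<in> track B"
  then obtain i l where "j + B * m = n i + B * l" "q = x i" by (auto simp: track_def)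
  moreover from this have "j = n i + B * (l - m)" by (simp add: algebra_simps)
  ultimately show "(j, q) \<in> track B" using track_memI[of i "l - m"] by simp
qed

text \<open>Every line occurs at arbitrarily late times, so that there is room to follow it
  backwards.\<close>

lemma track_late:
  assumes "(j, q) \<in> track B"
  obtains i m where "i \<ge> M" "j = n i + B * m" "q = x i"
proof -
  obtain i m where im: "j = n i + B * m" "q = x i" using assms by (auto simp: track_def)
  obtain b where b: "\<delta> = B * b" using B by auto
  have "i + 2 * k * M \<ge> M" using k by (simp add: trans_le_add2)
  then show ?thesis
  proof (rule that[of _ "m - b * int M"])
    show "j = n (i + 2 * k * M) + B * (m - b * int M)"
      unfolding n_per' im b by (simp add: algebra_simps)
    show "q = x (i + 2 * k * M)" unfolding x_per' im by simp
  qed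
qed

lemma strands_track: "strands (track B)"
  unfolding strands_def
proof (intro conjI allI)
  fix j
  have "fib (track B) j \<subseteq> x ` {..<2 * k}"
  proof
    fix q assume "q \<in> fib (track B) j"
    then obtain i where "q = x i" by (auto simp: track_def)
    then have "q = x (i mod (2 * k))" using x_per'[of "i mod (2*k)" "i div (2*k)"] by simp
    then show "q \<in> x ` {..<2 * k}" using k by auto
  qed
  then show "finite (fib (track B) j)" by (rule finite_subset) simp
next
  show "follows (track B)"
    unfolding follows_def
  proof (intro allI impI)
    fix j q assume "(j, q) \<in> track B"
    then obtain i m where im: "j = n i + B * m" "q = x i" by (auto simp: track_def)
    obtain d h where d: "d \<in> {1,-1}" "crosses d (n i) (x i)" "n h = n i + d" "x h = x i + glide e d (n i)"
      using exit_segment[of i] by metis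
    have "(j + d, q + glide e d j) \<in> track B"
      using track_memI[of h m] d im by (simp add: shift_inv algebra_simps)
    then show "\<exists>d\<in>{1, -1}. crosses d j q \<and> (j + d, q + glide e d j) \<in> track B"
      using d im shift_inv(5) by blast
  qed
next
  show "follows (flip (track B))"
    unfolding follows_def
  proof (intro allI impI)
    fix j q assume "(j, q) \<in> flip (track B)"
    then have "(j, -q) \<in> track B" by simp
    from track_late[OF this, of 2] obtain i m where "i \<ge> 2" "j = n i + B * m" "- q = x i"
      by blast
    then have im: "i \<ge> 2" "j = n i + B * m" "q = - x i" by auto
    obtain d h where d: "d \<in> {1,-1}" "crosses d (n i) (- x i)" "n h = n i + d" "- x h = - x i + glide e d (n i)"
      using entry_segment[OF im(1)] by metis
    have "(j + d, - (q + glide e d j)) \<in> track B"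
      using track_memI[of h m] d im by (simp add: shift_inv algebra_simps)
    then show "\<exists>d\<in>{1, -1}. crosses d j q \<and> (j + d, q + glide e d j) \<in> flip (track B)"
      using d im shift_inv(5) by auto
  qed
qed

lemma left_count_shift:
  "left_count (track B) (j + B * m) q = left_count (track B) j q"
  "left_count (flip (track B)) (j + B * m) q = left_count (flip (track B)) j q"
  by (simp_all add: left_count_def track_shift)

lemma potential_shift: "potential (track B) (j + B * m) q = potential (track B) j q"
  by (simp add: potential_def left_count_shift shift_inv)

lemma potential_track:
  "potential (track B) (n i) (x i) = potential (track B) (n 0) (x 0)"
  "potential (track B) (n i) (- x i) = potential (track B) (n 0) (- x 0)"
proof (induction i)
  case (Suc i)
  { case 1
    show ?case
    proof (cases "c (Suc i) = Edge3")
      case True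
      then show ?thesis using base[OF True] n_Suc[of i] Suc by simp
    next
      case False
      note s = side'[OF False] and d = turn_unit[OF False, of i]
      show ?thesis
        using potential_cross[OF strands_track d s(1)] s(2) n_Suc[of i] Suc by simp
    qed
  next
    case 2
    show ?case
    proof (cases "c (Suc i) = Edge3")
      case True
      then show ?thesis using base[OF True] n_Suc[of i] Suc by simp
    next
      case False
      note s = side'[OF False] and d = turn_unit[OF False, of i]
      note cb = crosses_back[OF d s(1)]
      have d': "- turn i (c (Suc i)) \<in> {1,-1}" using d by auto
      show ?thesis
        using potential_cross[OF strands_track d' cb(1)] cb(2) s(2) n_Suc[of i] Suc by simp
    qed
  }
qed simp_all

lemma flux_track: "\<bar>flux (track B) 0\<bar> \<le> 1"
proof (rule flux_le_1[OF strands_track])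
  fix j q
  show "potential (track B) j q = potential (track B) (n 0) (x 0)" if "(j, q) \<in> track B"
    using that potential_track potential_shift by (auto simp: track_def)
  show "potential (track B) j q = potential (track B) (n 0) (- x 0)" if "(j, q) \<in> flip (track B)"
  proof -
    have "(j, -q) \<in> track B" using that by simp
    then obtain i m where im: "j = n i + B * m" "- q = x i" unfolding track_def by blast
    then have "q = - x i" by linarith
    then show ?thesis using potential_track(2)[of i] potential_shift im(1) by simp
  qed
qed

end

section \<open>Symmetry of the word\<close>

context folded_path
begin

lemma turn_swap: "even (i + j) \<Longrightarrow> turn i a \<noteq> 0 \<Longrightarrow> turn i a = - turn j b \<Longrightarrow> a = swap_edge b"
  by (cases a; cases b) (auto split: if_splits)

lemma turn_same: "odd (i + j) \<Longrightarrow> turn i a \<noteq> 0 \<Longrightarrow> turn i a = turn j b \<Longrightarrow> a = swap_edge b"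
  by (cases a; cases b) (auto split: if_splits)

lemma exit_side:
  assumes "d \<in> {1, -1}" "goes d (n i) (x i)"
  shows "c (Suc i) = Edge3 \<longleftrightarrow> sg i * e (wall d (n i)) < 0"
    and "c (Suc i) \<noteq> Edge3 \<Longrightarrow> d = turn i (c (Suc i)) \<and> sg i * e (wall d (n i)) > 0"
proof -
  obtain d' where d': "d' \<in> {1, -1}" "crosses d' (n i) (x i)"
    "c (Suc i) \<noteq> Edge3 \<Longrightarrow> d' = turn i (c (Suc i)) \<and> sg i * e (wall d' (n i)) > 0"
    "c (Suc i) = Edge3 \<Longrightarrow> sg i * e (wall d' (n i)) < 0"
    using exit_segment[of i] by metis
  have "d' = d" using goes_unique[OF d'(1) assms(1) _ assms(2)] d'(2) by (simp add: crosses_def)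
  then show "c (Suc i) = Edge3 \<longleftrightarrow> sg i * e (wall d (n i)) < 0"
    "c (Suc i) \<noteq> Edge3 \<Longrightarrow> d = turn i (c (Suc i)) \<and> sg i * e (wall d (n i)) > 0"
    using d'(3,4) by (cases "c (Suc i) = Edge3"; simp)+
qed

lemma entry_side:
  assumes "i \<ge> 1" "d \<in> {1, -1}" "goes d (n (Suc i)) (- x (Suc i))"
  shows "c (Suc i) = Edge3 \<longleftrightarrow> sg i * e (wall d (n (Suc i))) < 0"
    and "c (Suc i) \<noteq> Edge3 \<Longrightarrow> d = - turn i (c (Suc i)) \<and> sg i * e (wall d (n (Suc i))) > 0"
proof -
  have "Suc i \<ge> 2" using assms by simp
  then obtain d' where d': "d' \<in> {1, -1}" "crosses d' (n (Suc i)) (- x (Suc i))"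
    "c (Suc i) \<noteq> Edge3 \<Longrightarrow> d' = - turn i (c (Suc i)) \<and> sg i * e (wall d' (n (Suc i))) > 0"
    "c (Suc i) = Edge3 \<Longrightarrow> sg i * e (wall d' (n (Suc i))) < 0"
    using entry_segment[of "Suc i"] by (metis diff_Suc_1)
  have "d' = d" using goes_unique[OF d'(1) assms(2) _ assms(3)] d'(2) by (simp add: crosses_def)
  then show "c (Suc i) = Edge3 \<longleftrightarrow> sg i * e (wall d (n (Suc i))) < 0"
    "c (Suc i) \<noteq> Edge3 \<Longrightarrow> d = - turn i (c (Suc i)) \<and> sg i * e (wall d (n (Suc i))) > 0"
    using d'(3,4) by (cases "c (Suc i) = Edge3"; simp)+
qed

lemma exit_dir: obtains d where "d \<in> {1, -1}" "goes d (n i) (x i)"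
  using exit_segment[of i] by (metis crosses_def)

end

locale folded_period_pos = folded_period + assumes eps1: "\<epsilon> = 1"
begin

lemma e_same: "e (j + B * m) = e j"
proof (induction m rule: int_induct[where k = 0])
  case (step1 i)
  have "j + B * (i + 1) = j + B * i + B" by (simp add: algebra_simps)
  then show ?case using e_shift[of "j + B * i"] eps1 step1 by (metis mult_1)
next
  case (step2 i)
  have "j + B * (i - 1) + B = j + B * i" by (simp add: algebra_simps)
  then show ?case using e_shift[of "j + B * (i - 1)"] eps1 step2 by (metis mult_1)
qed simp

text \<open>The segments \<open>i\<close> and \<open>j\<close> lie in the same rhombus, in opposite halves of it, and the line of \<open>i\<close>
  has as many lines on its left as the line of \<open>j\<close> has on its right.\<close>

definition mirrored :: "nat \<Rightarrow> nat \<Rightarrow> bool" where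
  "mirrored i j \<longleftrightarrow> odd (i + j) \<and> B dvd n i - n j \<and>
     left_count (track B) (n i) (x i) = left_count (flip (track B)) (n i) (- x j)"

text \<open>As the line of \<open>i\<close> and the image of the line of \<open>j + 1\<close> under the half turn have the same rank,
  they leave the rhombus through the same side. So the line of \<open>j + 1\<close> came in through the opposite
  side, which is the copy of the other edge of the triangle in the other half.\<close>

lemma mirrored_step:
  assumes fl: "flux (track B) 0 = 0" and j: "j \<ge> 1" and R: "mirrored i (Suc j)"
  shows "c (Suc i) = swap_edge (c (Suc j)) \<and> mirrored (Suc i) j"
proof -
  let ?A = "track B"
  note S = strands_track and S' = strands_flip[OF strands_track]
  note eq = zero_flux_exits[OF S fl]
  obtain m where m: "n i = n (Suc j) + B * m"
    using R unfolding mirrored_def by (metis diff_eq_eq dvdE add.commute)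
  have ai: "(n i, x i) \<in> ?A" using track_memI[of i 0] by simp
  have aj: "(n i, - x (Suc j)) \<in> flip ?A" using track_memI[of "Suc j" m] m by simp
  have rk: "left_count ?A (n i) (x i) = left_count (flip ?A) (n i) (- x (Suc j))"
    and par: "even (i + j)" using R by (auto simp: mirrored_def)
  have sgij: "sg i = sg j" using par by (auto simp: sg_def)
  obtain d where d: "d \<in> {1, -1}" "goes d (n i) (x i)" by (rule exit_dir)
  have "goes d (n i) (- x (Suc j))"
    using same_rank_goes[OF S S' d(1) eq ai aj rk] d(2) by blast
  then have gj: "goes d (n (Suc j)) (- x (Suc j))" using m shift_inv(4) by simp
  note X = exit_side[OF d] and Y = entry_side[OF j d(1) gj]
  have ew: "e (wall d (n i)) = e (wall d (n (Suc j)))"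
  proof -
    have "wall d (n i) = wall d (n (Suc j)) + B * m" by (simp add: m wall_def)
    then show ?thesis by (simp add: e_same)
  qed
  have b: "c (Suc i) = Edge3 \<longleftrightarrow> c (Suc j) = Edge3" using X(1) Y(1) ew sgij by simp
  show ?thesis
  proof (cases "c (Suc i) = Edge3")
    case True
    then have "c (Suc j) = Edge3" using b by simp
    then show ?thesis using True R base[of i] base[of j] n_Suc[of i] n_Suc[of j]
      by (simp add: mirrored_def)
  next
    case False
    then have Fj: "c (Suc j) \<noteq> Edge3" using b by simp
    have di: "d = turn i (c (Suc i))" and dj: "d = - turn j (c (Suc j))" using X(2) Y(2) False Fj by auto
    have sw: "c (Suc i) = swap_edge (c (Suc j))"
      using turn_swap[OF par] di dj d(1) by auto
    have ni: "n (Suc i) = n i + d" "x (Suc i) = x i + glide e d (n i)"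
      using n_Suc[of i] side'(2)[OF False] di by auto
    have tj: "turn j (c (Suc j)) = - d" using dj by simp
    have nj: "n j = n (Suc j) + d" using n_Suc[of j] tj by simp
    have "glide e (-d) (n j) = glide e d (n (Suc j))"
      using T_sym[OF d(1), of "n (Suc j)"] nj by simp
    also have "\<dots> = glide e d (n i)" using m shift_inv(3) by simp
    finally have xj: "- x j = - x (Suc j) + glide e d (n i)"
      using side'(2)[OF Fj] tj by simp
    have "left_count ?A (n i + d) (x i + glide e d (n i)) =
        left_count (flip ?A) (n i + d) (- x (Suc j) + glide e d (n i))"
      by (rule same_rank_cross[OF S S' d(1) eq ai aj rk d(2)])
    moreover have "B dvd n i + d - n j"
    proof -
      have "n i + d - n j = n i - n (Suc j)" using nj by simp
      then show ?thesis using R by (simp only: mirrored_def)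
    qed
    ultimately have "mirrored (Suc i) j"
      using par ni xj by (simp add: mirrored_def)
    then show ?thesis using sw by simp
  qed
qed

lemma mirrored_start:
  assumes "flux (track B) 0 = 0"
  obtains i j where "j \<ge> M" "mirrored i j"
proof -
  let ?A = "track B"
  \<comment> \<open>The segments before and after a strike on the base are on the same line in opposite halves, so one of them has the parity that \<open>mirrored\<close> asks for.\<close>
  have ck: "c (Suc (k - 1)) = Edge3" using c_per[of 0] c0 k by simp
  have nk: "n (Suc (k - 1)) = n (k - 1)" "x (Suc (k - 1)) = x (k - 1)"
    using n_Suc[of "k - 1"] base[OF ck] ck by auto
  let ?n = "n (k - 1)" and ?x = "x (k - 1)"
  have "(?n, ?x) \<in> ?A" using track_memI[of "k - 1" 0] by simp
  then have "{z \<in> fib ?A ?n. z < ?x} \<subseteq> fib ?A ?n - {?x}" and "?x \<in> fib ?A ?n" by auto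
  then have "left_count ?A ?n ?x < card (fib ?A ?n)"
    unfolding left_count_def using strands_finite[OF strands_track]
    by (meson card_Diff1_less card_mono finite_Diff le_less_trans)
  then obtain y where y: "y \<in> fib (flip ?A) ?n" "left_count (flip ?A) ?n y = left_count ?A ?n ?x"
    using ex_left_count[of "flip ?A" ?n] strands_finite[OF strands_flip[OF strands_track]] card_fib_flip
    by metis
  then have "(?n, -y) \<in> ?A" by simp
  then obtain j m where jm: "j \<ge> M" "?n = n j + B * m" "- y = x j" using track_late by metis
  then have yx: "y = - x j" by simp
  have base': "B dvd ?n - n j" using jm by simp
  show ?thesis
  proof (cases "odd (k - 1 + j)")
    case True
    then have "mirrored (k - 1) j" using y yx base' by (simp add: mirrored_def)
    then show ?thesis using that jm by blast
  next
    case False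
    then have "mirrored (Suc (k - 1)) j" using y yx base' nk by (simp add: mirrored_def)
    then show ?thesis using that jm by blast
  qed
qed

lemma word_palindromic:
  assumes fl: "flux (track B) 0 = 0"
  shows "\<exists>p q. \<forall>m<k. c (p + m) = swap_edge (c (q + (k - 1 - m)))"
proof -
  obtain i j where ij: "j \<ge> k + 1" "mirrored i j" by (rule mirrored_start[OF fl])
  have "mirrored (i + m) (j - m) \<and> (m > 0 \<longrightarrow> c (i + m) = swap_edge (c (j + 1 - m)))" if "m \<le> k" for m
    using that
  proof (induction m)
    case (Suc m)
    then have "mirrored (i + m) (Suc (j - Suc m))" "j - Suc m \<ge> 1" using ij by (auto simp: Suc_diff_Suc)
    from mirrored_step[OF fl this(2,1)] show ?case using Suc.prems ij by (auto simp: Suc_diff_Suc)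
  qed (use ij in simp)
  then have *: "c (i + m) = swap_edge (c (j + 1 - m))" if "m \<le> k" "m > 0" for m using that by blast
  have "c (i + 1 + m) = swap_edge (c (j - k + 1 + (k - 1 - m)))" if "m < k" for m
  proof -
    have "j + 1 - Suc m = j - k + 1 + (k - 1 - m)" using that ij by auto
    then show ?thesis using *[of "Suc m"] that by simp
  qed
  then show ?thesis by blast
qed

end

context folded_path
begin

text \<open>If two segments have the same position in rhombi whose numbers differ by \<open>N\<close> modulo \<open>2 * N\<close>, then
  their directions in the frame of the rhombus are opposite. So the half turn, without reversal of
  time, maps one line to the other, and it exchanges the edges.\<close>

lemma shifted_word:
  assumes neg: "\<And>j. e (j + N) = - e j" and N: "2 * N dvd \<delta>"
    and meet: "n i = n j + N + 2 * N * m" "x i = x j"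
  shows "\<exists>p q. \<forall>l. c (p + l) = swap_edge (c (q + l))"
proof -
  interpret P: folded_period e k c n x \<delta> N "-1"
    using neg N by unfold_locales (auto intro: dvd_mult_left)
  have odd_shift: "e (j + N * (2 * m + 1)) = - e j" for j m
  proof (induction m rule: int_induct[where k = 0])
    case (step1 i)
    have "j + N * (2 * (i + 1) + 1) = j + N * (2 * i + 1) + N + N" by (simp add: algebra_simps)
    then show ?case by (simp only: neg step1 minus_minus)
  next
    case (step2 i)
    have "j + N * (2 * i + 1) = j + N * (2 * (i - 1) + 1) + N + N" by (simp add: algebra_simps)
    then have "e (j + N * (2 * i + 1)) = e (j + N * (2 * (i - 1) + 1))" by (simp only: neg minus_minus)
    then show ?case using step2 by simp
  qed (simp add: neg)
  define twin where "twin p q \<longleftrightarrow> n p = n q + N * (2 * m + 1) \<and> x p = x q" for p q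
  have sides: "\<exists>d\<in>{1,-1}. goes d (n p) (x p) \<and> goes d (n q) (x q) \<and> e (wall d (n p)) = - e (wall d (n q))"
    if tw: "twin p q" for p q
  proof -
    obtain d where d: "d \<in> {1,-1}" "goes d (n p) (x p)" by (rule exit_dir)
    have "goes d (n q) (x q)" using d tw P.shift_inv(4) by (simp add: twin_def)
    moreover have "wall d (n p) = wall d (n q) + N * (2 * m + 1)" using tw by (simp add: twin_def wall_def)
    ultimately show ?thesis using d odd_shift by metis
  qed
  have step: "c (Suc p) = swap_edge (c (Suc q)) \<and> twin (Suc p) (Suc q)"
    if tw: "twin p q" and od: "odd (p + q)" for p q
  proof -
    obtain d where d: "d \<in> {1,-1}" "goes d (n p) (x p)" "goes d (n q) (x q)"
      "e (wall d (n p)) = - e (wall d (n q))" using sides[OF tw] by blast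
    note X = exit_side[OF d(1,2)] and Y = exit_side[OF d(1,3)]
    have "sg p = - sg q" using od by (auto simp: sg_def)
    then have b: "c (Suc p) = Edge3 \<longleftrightarrow> c (Suc q) = Edge3" using X(1) Y(1) d(4) by simp
    show ?thesis
    proof (cases "c (Suc p) = Edge3")
      case True
      then show ?thesis using b tw n_Suc[of p] n_Suc[of q] base[of p] base[of q] by (simp add: twin_def)
    next
      case False
      then have t: "turn p (c (Suc p)) = d" "turn q (c (Suc q)) = d" using X(2) Y(2) b by auto
      have "c (Suc p) = swap_edge (c (Suc q))" using turn_same[OF od] t d(1) by auto
      moreover have "glide e d (n p) = glide e d (n q)" using tw P.shift_inv(3) by (simp add: twin_def)
      ultimately show ?thesis
        using tw side'(2)[OF False] side'(2)[of q] False b t n_Suc[of p] n_Suc[of q] by (simp add: twin_def)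
    qed
  qed
  have tw: "twin i j" using meet by (simp add: twin_def algebra_simps)
  \<comment> \<open>The two lines leave through opposite halves. If the segments start in the same half, then exactly one of them strikes the base next, and the segment after it is in the other half.\<close>
  obtain p q where pq: "twin p q" "odd (p + q)"
  proof (cases "odd (i + j)")
    case True
    then show ?thesis using that tw by blast
  next
    case False
    obtain d where d: "d \<in> {1,-1}" "goes d (n i) (x i)" "goes d (n j) (x j)"
      "e (wall d (n i)) = - e (wall d (n j))" using sides[OF tw] by blast
    note X = exit_side[OF d(1,2)] and Y = exit_side[OF d(1,3)]
    have s: "sg i = sg j" using False by (auto simp: sg_def)
    show ?thesis
    proof (cases "c (Suc i) = Edge3")
      case True
      then have "twin (Suc i) j" using tw n_Suc[of i] base[OF True] by (simp add: twin_def)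
      then show ?thesis using that False by auto
    next
      case F: False
      have "sg j * - e (wall d (n j)) > 0" using X(2)[OF F] s d(4) by metis
      then have "sg j * e (wall d (n j)) < 0" by simp
      then have T: "c (Suc j) = Edge3" using Y(1) by simp
      then have "twin i (Suc j)" using tw n_Suc[of j] base[OF T] by (simp add: twin_def)
      then show ?thesis using that False by auto
    qed
  qed
  have od: "odd (p + l + (q + l))" for l using pq(2) by presburger
  have all: "twin (p + l) (q + l)" for l
  proof (induction l)
    case (Suc l)
    then show ?case using step[OF _ od] by simp
  qed (simp add: pq)
  have "c (Suc p + l) = swap_edge (c (Suc q + l))" for l
    using step[OF all od, of l] by simp
  then show ?thesis by blast
qed

text \<open>Modulo \<open>N\<close>, the path is the union of the path modulo \<open>2 * N\<close> and its shift by \<open>N\<close>.\<close>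

lemma track_union:
  assumes neg: "\<And>j. e (j + N) = - e j" and N: "2 * N dvd \<delta>"
    and disj: "\<And>i j m. n i = n j + N + 2 * N * m \<Longrightarrow> x i \<noteq> x j"
  shows "flux (track N) 0 = 2 * flux (track (2 * N)) 0"
proof -
  interpret P: folded_period e k c n x \<delta> N "-1"
    using neg N by unfold_locales (auto intro: dvd_mult_left)
  interpret Q: folded_period e k c n x \<delta> "2 * N" 1
  proof
    fix m show "e (m + 2 * N) = 1 * e m" using neg[of "m + N"] neg[of m] by (simp add: algebra_simps)
  qed (use N in auto)
  have mem: "(j, q) \<in> track N \<longleftrightarrow> (j, q) \<in> track (2 * N) \<or> (j - N, q) \<in> track (2 * N)" for j q
  proof
    assume "(j, q) \<in> track N"
    then obtain i m where im: "j = n i + N * m" "q = x i" by (auto simp: track_def)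
    show "(j, q) \<in> track (2 * N) \<or> (j - N, q) \<in> track (2 * N)"
    proof (cases "even m")
      case True
      then obtain l where "m = 2 * l" by blast
      then show ?thesis using im Q.track_memI[of i l] by (simp add: algebra_simps)
    next
      case False
      then obtain l where "m = 2 * l + 1" using oddE by blast
      then show ?thesis using im Q.track_memI[of i l] by (simp add: algebra_simps)
    qed
  next
    assume "(j, q) \<in> track (2 * N) \<or> (j - N, q) \<in> track (2 * N)"
    then show "(j, q) \<in> track N"
    proof
      assume "(j, q) \<in> track (2 * N)"
      then obtain i m where "j = n i + 2 * N * m" "q = x i" by (auto simp: track_def)
      then show ?thesis using P.track_memI[of i "2 * m"] by (simp add: algebra_simps)
    next
      assume "(j - N, q) \<in> track (2 * N)"
      then obtain i m where "j - N = n i + 2 * N * m" "q = x i" by (auto simp: track_def)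
      moreover from this have "j = n i + N * (2 * m + 1)" by (simp add: algebra_simps)
      ultimately show ?thesis using P.track_memI[of i "2 * m + 1"] by simp
    qed
  qed
  have not_both: "\<not> ((j, q) \<in> track (2 * N) \<and> (j - N, q) \<in> track (2 * N))" for j q
  proof
    assume "(j, q) \<in> track (2 * N) \<and> (j - N, q) \<in> track (2 * N)"
    then obtain i m i' m' where "j = n i + 2 * N * m" "q = x i" "j - N = n i' + 2 * N * m'" "q = x i'"
      unfolding track_def by blast
    moreover from this have "n i = n i' + N + 2 * N * (m' - m)" by (simp add: algebra_simps)
    ultimately show False using disj by metis
  qed
  have g: "goes d (j - N) q = goes d j q" for d j q
    using P.shift_inv(4)[of d "j - N" 1 q] by simp
  have ex: "card (exits (track N) d j) = card (exits (track (2 * N)) d j) + card (exits (track (2 * N)) d (j - N))" for d j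
  proof -
    have "exits (track N) d j = exits (track (2 * N)) d j \<union> exits (track (2 * N)) d (j - N)"
      by (auto simp: exits_def mem g)
    moreover have "exits (track (2 * N)) d j \<inter> exits (track (2 * N)) d (j - N) = {}"
      using not_both by (auto simp: exits_def)
    ultimately show ?thesis using finite_exits[OF Q.strands_track] by (simp add: card_Un_disjoint)
  qed
  have "flux (track N) 0 = flux (track (2 * N)) 0 + flux (track (2 * N)) (- N)"
    using ex[of 1 0] ex[of "-1" 1] by (simp add: flux_def)
  then show ?thesis using flux_const[OF Q.strands_track, of "-N"] by simp
qed

lemma flux_closed:
  assumes "\<delta> = 0"
  shows "flux (track 0) 0 = 0"
proof -
  interpret Q: folded_period e k c n x \<delta> 0 1
    using assms by unfold_locales auto
  \<comment> \<open>The numbers on a closed path are bounded, and the flux vanishes beyond the bound.\<close>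
  define M where "M = Max (n ` {..<2 * k})"
  have le: "n i \<le> M" for i
  proof -
    have "n i = n (i mod (2 * k))" using n_per'[of "i mod (2*k)" "i div (2*k)"] assms by simp
    also have "\<dots> \<le> M" unfolding M_def using k by (intro Max_ge) auto
    finally show ?thesis .
  qed
  have "fib (track 0) j = {}" if "j > M" for j
  proof -
    have "(j, q) \<notin> track 0" for q
    proof
      assume "(j, q) \<in> track 0"
      then obtain i where "j = n i" by (auto simp: track_def)
      then show False using le[of i] that by simp
    qed
    then show ?thesis by auto
  qed
  then have "exits (track 0) d j = {}" if "j > M" for d j using that by (simp add: exits_def)
  then have "flux (track 0) (M + 1) = 0" by (simp add: flux_def)
  then show ?thesis using flux_const[OF Q.strands_track] by metis
qed

theorem word_symmetry:
  assumes "\<delta> = 0 \<or> (\<exists>N. 2 * N dvd \<delta> \<and> (\<forall>j. e (j + N) = - e j))"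
  shows "(\<exists>p q. \<forall>m<k. c (p + m) = swap_edge (c (q + (k - 1 - m)))) \<or>
    (\<exists>p q. \<forall>l. c (p + l) = swap_edge (c (q + l)))"
  using assms
proof
  assume "\<delta> = 0"
  then interpret Q: folded_period_pos e k c n x \<delta> 0 1
    by unfold_locales auto
  show ?thesis using Q.word_palindromic[OF flux_closed[OF \<open>\<delta> = 0\<close>]] by blast
next
  assume "\<exists>N. 2 * N dvd \<delta> \<and> (\<forall>j. e (j + N) = - e j)"
  then obtain N where N: "2 * N dvd \<delta>" "\<And>j. e (j + N) = - e j" by blast
  interpret P: folded_period e k c n x \<delta> N "-1"
    using N by unfold_locales (auto intro: dvd_mult_left)
  interpret Q: folded_period_pos e k c n x \<delta> "2 * N" 1
  proof
    fix m show "e (m + 2 * N) = 1 * e m" using N(2)[of "m + N"] N(2)[of m] by (simp add: algebra_simps)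
  qed (use N in auto)
  show ?thesis
  proof (cases "\<exists>i j m. n i = n j + N + 2 * N * m \<and> x i = x j")
    case True
    then show ?thesis using shifted_word[OF N(2,1)] by blast
  next
    case False
    then have "flux (track N) 0 = 2 * flux (track (2 * N)) 0" using track_union[OF N(2,1)] by blast
    then have "flux (track (2 * N)) 0 = 0" using P.flux_track by linarith
    then show ?thesis using Q.word_palindromic by blast
  qed
qed

end

section \<open>Moving and mirroring a periodic trajectory\<close>

lemma periodic_trajectoryI:
  assumes "length C = k" "k > 0" "t 0 = (0::real)" "t k = 1" "f 1 = f 0"
    and "\<And>i. i < k \<Longrightarrow> t i < t (Suc i) \<and> f (t i) \<in> edge_interior T (C ! i) \<and> v i \<noteq> 0 \<and>
      (\<forall>s\<in>{t i..t (Suc i)}. f s = f (t i) + (s - t i) *\<^sub>R v i) \<and>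
      (\<forall>s\<in>{t i<..<t (Suc i)}. f s \<in> interior (region T)) \<and>
      v (Suc i mod k) = reflect_dir T (C ! (Suc i mod k)) (v i)"
  shows "periodic_trajectory T f C"
  unfolding periodic_trajectory_def Let_def assms(1) using assms(2-) by blast

lemma periodic_rotate1:
  assumes "periodic_trajectory T f C"
  shows "\<exists>f'. periodic_trajectory T f' (rotate1 C)"
proof -
  define k where "k = length C"
  obtain t v where k0: "k > 0" and t0: "t 0 = (0::real)" and tk: "t k = 1" and f1: "f 1 = f 0"
    and P: "\<And>i. i < k \<Longrightarrow> t i < t (Suc i) \<and> f (t i) \<in> edge_interior T (C ! i) \<and> v i \<noteq> 0 \<and>
                 (\<forall>s\<in>{t i..t (Suc i)}. f s = f (t i) + (s - t i) *\<^sub>R v i) \<and>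
                 (\<forall>s\<in>{t i<..<t (Suc i)}. f s \<in> interior (region T)) \<and>
                 v (Suc i mod k) = reflect_dir T (C ! (Suc i mod k)) (v i)"
    using assms unfolding periodic_trajectory_def k_def[symmetric] Let_def by blast
  have P1: "t i < t (Suc i)" "f (t i) \<in> edge_interior T (C ! i)" "v i \<noteq> 0"
    "v (Suc i mod k) = reflect_dir T (C ! (Suc i mod k)) (v i)" if "i < k" for i
    using P[OF that] by blast+
  define a where "a = t 1"
  have a: "0 < a" using P1(1)[of 0] k0 t0 by (simp add: a_def)
  have mono: "t i \<le> t j" if "i \<le> j" "j \<le> k" for i j
    using that
  proof (induction j)
    case (Suc j)
    then show ?case using P1(1)[of j] by (cases "i = Suc j") auto
  qed simp
  have a1: "a \<le> 1" using mono[of 1 k] k0 tk by (simp add: a_def)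
  define t' where "t' i = (if i < k then t (Suc i) - a else 1)" for i
  define v' where "v' i = v (Suc i mod k)" for i
  define f' where "f' s = (if s \<le> 1 - a then f (s + a) else f (s + a - 1))" for s
  have C': "rotate1 C ! i = C ! (Suc i mod k)" if "i < k" for i
    using that by (simp add: nth_rotate1 k_def)
  have seg: "t' i < t' (Suc i) \<and> f' (t' i) \<in> edge_interior T (C ! (Suc i mod k)) \<and> v' i \<noteq> 0 \<and>
      (\<forall>s\<in>{t' i..t' (Suc i)}. f' s = f' (t' i) + (s - t' i) *\<^sub>R v' i) \<and>
      (\<forall>s\<in>{t' i<..<t' (Suc i)}. f' s \<in> interior (region T)) \<and>
      v' (Suc i mod k) = reflect_dir T (C ! (Suc (Suc i mod k) mod k)) (v' i)" if i: "i < k" for i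
  proof (cases "Suc i < k")
    case True
    note Q = P[OF True]
    have le: "t (Suc (Suc i)) \<le> 1" using mono[of "Suc (Suc i)" k] True tk by simp
    have t': "t' i = t (Suc i) - a" "t' (Suc i) = t (Suc (Suc i)) - a"
      using True i by (auto simp: t'_def)
    have f': "f' s = f (s + a)" if "s \<le> t' (Suc i)" for s using that le by (simp add: f'_def t')
    have "t' i \<le> t' (Suc i)" using P1(1)[OF True] by (simp add: t')
    then have fi: "f' (t' i) = f (t (Suc i))" using f' by (simp add: t')
    have e: "(s + a \<in> {t (Suc i)..t (Suc (Suc i))}) = (s \<in> {t' i..t' (Suc i)})"
      "(s + a \<in> {t (Suc i)<..<t (Suc (Suc i))}) = (s \<in> {t' i<..<t' (Suc i)})" for s
      by (auto simp: t')
    have 1: "\<forall>s\<in>{t' i..t' (Suc i)}. f' s = f' (t' i) + (s - t' i) *\<^sub>R v' i"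
    proof
      fix s assume s: "s \<in> {t' i..t' (Suc i)}"
      then have "f (s + a) = f (t (Suc i)) + (s + a - t (Suc i)) *\<^sub>R v (Suc i)"
        using Q e(1) by blast
      then show "f' s = f' (t' i) + (s - t' i) *\<^sub>R v' i"
        using s f' fi True by (simp add: t' v'_def algebra_simps)
    qed
    have 2: "\<forall>s\<in>{t' i<..<t' (Suc i)}. f' s \<in> interior (region T)"
      using Q e(2) f' by (metis greaterThanLessThan_iff less_imp_le)
    have m: "Suc i mod k = Suc i" using True by simp
    have "t' i < t' (Suc i)" "f' (t' i) \<in> edge_interior T (C ! (Suc i mod k))" "v' i \<noteq> 0"
      "v' (Suc i mod k) = reflect_dir T (C ! (Suc (Suc i mod k) mod k)) (v' i)"
      using P1[OF True] unfolding t' v'_def m fi[unfolded t'] by simp_all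
    then show ?thesis using 1 2 by blast
  next
    case False
    then have ik: "Suc i = k" using i by simp
    note Q = P[OF k0]
    have t': "t' i = 1 - a" "t' (Suc i) = 1" using ik i tk by (auto simp: t'_def)
    have fi: "f' (t' i) = f (t 0)" using f1 t0 by (simp add: f'_def t')
    have f': "f' s = f (s + a - 1)" if "s \<ge> t' i" for s using that f1 by (auto simp: f'_def t')
    have e: "(s + a - 1 \<in> {t 0..t (Suc 0)}) = (s \<in> {t' i..t' (Suc i)})"
      "(s + a - 1 \<in> {t 0<..<t (Suc 0)}) = (s \<in> {t' i<..<t' (Suc i)})" for s
      using t0 by (auto simp: t' a_def)
    have 1: "\<forall>s\<in>{t' i..t' (Suc i)}. f' s = f' (t' i) + (s - t' i) *\<^sub>R v' i"
    proof
      fix s assume s: "s \<in> {t' i..t' (Suc i)}"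
      then have "f (s + a - 1) = f (t 0) + (s + a - 1 - t 0) *\<^sub>R v 0"
        using Q e(1) by blast
      then show "f' s = f' (t' i) + (s - t' i) *\<^sub>R v' i"
        using s f' fi ik t0 by (simp add: t' v'_def algebra_simps)
    qed
    have 2: "\<forall>s\<in>{t' i<..<t' (Suc i)}. f' s \<in> interior (region T)"
      using Q e(2) f' by (metis greaterThanLessThan_iff less_imp_le)
    have m: "Suc i mod k = 0" using ik by simp
    have "t' i < t' (Suc i)" "f' (t' i) \<in> edge_interior T (C ! (Suc i mod k))" "v' i \<noteq> 0"
      "v' (Suc i mod k) = reflect_dir T (C ! (Suc (Suc i mod k) mod k)) (v' i)"
      using P1[OF k0] a unfolding t' v'_def m fi[unfolded t'] by simp_all
    then show ?thesis using 1 2 by blast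
  qed
  have ends: "t' 0 = 0" "t' k = 1" using k0 by (auto simp: t'_def a_def)
  have "f' 1 = f' 0" using a f1 a1 by (simp add: f'_def)
  have "periodic_trajectory T f' (rotate1 C)"
  proof (rule periodic_trajectoryI[of _ k t' f' T v'])
    fix i assume i: "i < k"
    have m: "Suc i mod k < k" using k0 by simp
    show "t' i < t' (Suc i) \<and> f' (t' i) \<in> edge_interior T (rotate1 C ! i) \<and> v' i \<noteq> 0 \<and>
      (\<forall>s\<in>{t' i..t' (Suc i)}. f' s = f' (t' i) + (s - t' i) *\<^sub>R v' i) \<and>
      (\<forall>s\<in>{t' i<..<t' (Suc i)}. f' s \<in> interior (region T)) \<and>
      v' (Suc i mod k) = reflect_dir T (rotate1 C ! (Suc i mod k)) (v' i)"
      unfolding C'[OF i] C'[OF m] by (rule seg[OF i])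
  qed (use k0 ends \<open>f' 1 = f' 0\<close> in \<open>simp_all add: k_def\<close>)
  then show ?thesis by blast
qed

lemma periodic_rotate:
  "periodic_trajectory T f C \<Longrightarrow> \<exists>f'. periodic_trajectory T f' (rotate m C)"
proof (induction m)
  case (Suc m)
  then show ?case using periodic_rotate1 by (metis rotate_Suc)
qed auto

lemma periodic_start: "periodic_trajectory T f C \<Longrightarrow> C \<noteq> [] \<and> f 0 \<in> edge_interior T (C ! 0)"
  unfolding periodic_trajectory_def Let_def by (metis length_greater_0_conv)

definition reflect :: "complex \<Rightarrow> complex" where "reflect z = 1 - cnj z"

lemma triangles_sum: "(\<theta>1, \<theta>2) \<in> triangles \<Longrightarrow> 0 < sin (\<theta>1 + \<theta>2)"
  by (auto simp: triangles_def intro!: sin_gt_zero)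

lemma reflect_apex:
  assumes "(\<theta>1, \<theta>2) \<in> triangles"
  shows "reflect (apex (\<theta>1, \<theta>2)) = apex (\<theta>2, \<theta>1)"
proof -
  have s: "sin (\<theta>1 + \<theta>2) \<noteq> 0" "sin (\<theta>2 + \<theta>1) = sin (\<theta>1 + \<theta>2)"
    using triangles_sum[OF assms] by (auto simp: add.commute)
  show ?thesis
  proof (rule complex_eqI)
    have "1 - sin \<theta>2 * cos \<theta>1 / sin (\<theta>1 + \<theta>2) = sin \<theta>1 * cos \<theta>2 / sin (\<theta>1 + \<theta>2)"
      using s(1) by (simp add: field_simps sin_add)
    then show "Re (reflect (apex (\<theta>1, \<theta>2))) = Re (apex (\<theta>2, \<theta>1))"
      by (simp add: reflect_def apex_def s(2))
    show "Im (reflect (apex (\<theta>1, \<theta>2))) = Im (apex (\<theta>2, \<theta>1))"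
      by (simp add: reflect_def apex_def s(2))
  qed
qed

lemma linear_neg_cnj: "linear (\<lambda>z. - cnj z)"
  by (rule linearI) (simp_all add: scaleR_conv_of_real)

lemma bij_neg_cnj: "bij (\<lambda>z. - cnj z)"
  by (rule o_bij[where g = "\<lambda>z. - cnj z"]) (auto simp: fun_eq_iff)

lemma reflect_image: "reflect ` S = (+) 1 ` ((\<lambda>z. - cnj z) ` S)"
  by (auto simp: reflect_def image_image)

lemma reflect_region:
  assumes "(\<theta>1, \<theta>2) \<in> triangles"
  shows "region (\<theta>2, \<theta>1) = reflect ` region (\<theta>1, \<theta>2)"
proof -
  have "reflect ` {0, 1, apex (\<theta>1, \<theta>2)} = {0, 1, apex (\<theta>2, \<theta>1)}"
    using reflect_apex[OF assms] by (auto simp: reflect_def)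
  then have "region (\<theta>2, \<theta>1) = convex hull ((+) 1 ` ((\<lambda>z. - cnj z) ` {0, 1, apex (\<theta>1, \<theta>2)}))"
    by (simp only: region_def reflect_image)
  also have "\<dots> = reflect ` region (\<theta>1, \<theta>2)"
    by (simp only: region_def reflect_image convex_hull_translation convex_hull_linear_image[OF linear_neg_cnj])
  finally show ?thesis .
qed

lemma reflect_interior: "interior (reflect ` S) = reflect ` interior S"
  unfolding reflect_image interior_translation
  using interior_bijective_linear_image[OF linear_neg_cnj bij_neg_cnj] by simp

text \<open>The mirror image reverses the orientation of the base.\<close>

lemma edge_ends_swap:
  assumes "(\<theta>1, \<theta>2) \<in> triangles"
  shows "edge_ends (\<theta>2, \<theta>1) (swap_edge a) =
    (let (p, q) = edge_ends (\<theta>1, \<theta>2) a in if a = Edge3 then (reflect q, reflect p) else (reflect p, reflect q))"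
  using reflect_apex[OF assms] by (cases a) (auto simp: reflect_def)

lemma reflect_segment: "reflect ` open_segment p q = open_segment (reflect p) (reflect q)"
proof -
  have "reflect ` open_segment p q = (+) 1 ` ((\<lambda>z. - cnj z) ` open_segment p q)" by (rule reflect_image)
  also have "(\<lambda>z. - cnj z) ` open_segment p q = open_segment (- cnj p) (- cnj q)"
    using open_segment_linear_image[OF linear_neg_cnj] bij_neg_cnj by (metis bij_is_inj)
  also have "(+) 1 ` \<dots> = open_segment (reflect p) (reflect q)"
    using open_segment_translation[of 1 "- cnj p" "- cnj q"] by (simp add: reflect_def)
  finally show ?thesis .
qed

lemma edge_interior_swap:
  assumes "(\<theta>1, \<theta>2) \<in> triangles"
  shows "edge_interior (\<theta>2, \<theta>1) (swap_edge a) = reflect ` edge_interior (\<theta>1, \<theta>2) a"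
  unfolding edge_interior_def edge_ends_swap[OF assms]
  by (auto simp: Let_def reflect_segment open_segment_commute split: prod.splits)

lemma reflect_dir_swap:
  assumes "(\<theta>1, \<theta>2) \<in> triangles"
  shows "reflect_dir (\<theta>2, \<theta>1) (swap_edge a) (- cnj v) = - cnj (reflect_dir (\<theta>1, \<theta>2) a v)"
proof -
  obtain p q where pq: "edge_ends (\<theta>1, \<theta>2) a = (p, q)" by fastforce
  have d: "reflect y - reflect z = cnj z - cnj y" for y z by (simp add: reflect_def)
  have 1: "(cnj p - cnj q) / (p - q) = (cnj q - cnj p) / (q - p)"
    by (metis minus_diff_eq minus_divide_divide)
  then have 2: "(cnj p - cnj q) * v / (p - q) = (cnj q - cnj p) * v / (q - p)"
    by (metis times_divide_eq_left)
  show ?thesis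
    unfolding reflect_dir_def edge_ends_swap[OF assms] pq
    using 1 2 by (simp add: Let_def d reflect_def split: if_splits)
qed

lemma periodic_swap:
  assumes T: "(\<theta>1, \<theta>2) \<in> triangles" and P: "periodic_trajectory (\<theta>1, \<theta>2) f C"
  shows "periodic_trajectory (\<theta>2, \<theta>1) (reflect \<circ> f) (map swap_edge C)"
proof -
  define k where "k = length C"
  obtain t v where k0: "k > 0" and t: "t 0 = (0::real)" "t k = 1" "f 1 = f 0"
    and P: "\<And>i. i < k \<Longrightarrow> t i < t (Suc i) \<and> f (t i) \<in> edge_interior (\<theta>1, \<theta>2) (C ! i) \<and> v i \<noteq> 0 \<and>
                 (\<forall>s\<in>{t i..t (Suc i)}. f s = f (t i) + (s - t i) *\<^sub>R v i) \<and>
                 (\<forall>s\<in>{t i<..<t (Suc i)}. f s \<in> interior (region (\<theta>1, \<theta>2))) \<and>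
                 v (Suc i mod k) = reflect_dir (\<theta>1, \<theta>2) (C ! (Suc i mod k)) (v i)"
    using P unfolding periodic_trajectory_def k_def[symmetric] Let_def by blast
  have P1: "t i < t (Suc i)" "f (t i) \<in> edge_interior (\<theta>1, \<theta>2) (C ! i)" "v i \<noteq> 0"
    "v (Suc i mod k) = reflect_dir (\<theta>1, \<theta>2) (C ! (Suc i mod k)) (v i)" if "i < k" for i
    using P[OF that] by blast+
  define w where "w i = - cnj (v i)" for i
  have seg: "t i < t (Suc i) \<and> reflect (f (t i)) \<in> edge_interior (\<theta>2, \<theta>1) (map swap_edge C ! i) \<and> w i \<noteq> 0 \<and>
        (\<forall>s\<in>{t i..t (Suc i)}. reflect (f s) = reflect (f (t i)) + (s - t i) *\<^sub>R w i) \<and>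
        (\<forall>s\<in>{t i<..<t (Suc i)}. reflect (f s) \<in> interior (region (\<theta>2, \<theta>1))) \<and>
        w (Suc i mod k) = reflect_dir (\<theta>2, \<theta>1) (map swap_edge C ! (Suc i mod k)) (w i)" if i: "i < k" for i
  proof -
    note Q = P[OF i]
    have lin: "reflect (y + s *\<^sub>R z) = reflect y + s *\<^sub>R (- cnj z)" for y z s
      by (simp add: reflect_def scaleR_conv_of_real)
    have m: "Suc i mod k < k" using k0 by simp
    have n1: "map swap_edge C ! i = swap_edge (C ! i)" using i by (simp add: k_def)
    have n2: "map swap_edge C ! (Suc i mod k) = swap_edge (C ! (Suc i mod k))"
      using m unfolding k_def by (rule nth_map)
    have "\<forall>s\<in>{t i..t (Suc i)}. reflect (f s) = reflect (f (t i)) + (s - t i) *\<^sub>R w i"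
      using Q lin unfolding w_def by metis
    moreover have "\<forall>s\<in>{t i<..<t (Suc i)}. reflect (f s) \<in> interior (region (\<theta>2, \<theta>1))"
      using Q unfolding reflect_region[OF T] reflect_interior by blast
    moreover have "w (Suc i mod k) = reflect_dir (\<theta>2, \<theta>1) (map swap_edge C ! (Suc i mod k)) (w i)"
      unfolding n2 w_def reflect_dir_swap[OF T] P1(4)[OF i] ..
    moreover have "reflect (f (t i)) \<in> edge_interior (\<theta>2, \<theta>1) (map swap_edge C ! i)"
      unfolding n1 edge_interior_swap[OF T] using P1(2)[OF i] by blast
    moreover have "w i \<noteq> 0" using P1(3)[OF i] by (simp add: w_def)
    ultimately show ?thesis using P1(1)[OF i] by blast
  qed
  have "periodic_trajectory (\<theta>2, \<theta>1) (\<lambda>s. reflect (f s)) (map swap_edge C)"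
    by (rule periodic_trajectoryI[where f = "\<lambda>s. reflect (f s)", OF _ k0 t(1,2) _ seg])
      (simp_all add: k_def t(3))
  then show ?thesis by (simp add: comp_def)
qed

section \<open>Unfolding a path in an isosceles triangle\<close>

locale isosceles =
  fixes \<theta> :: real
  assumes theta: "0 < \<theta>" "\<theta> < pi / 2"
begin

lemma sin_pos: "sin \<theta> > 0" and cos_pos: "cos \<theta> > 0"
  using theta by (auto intro: sin_gt_zero cos_gt_zero)

lemma apex_isosceles: "apex (\<theta>, \<theta>) = Complex (1/2) (sin \<theta> / (2 * cos \<theta>))"
proof -
  have "sin (\<theta> + \<theta>) = 2 * sin \<theta> * cos \<theta>" using sin_double[of \<theta>] by simp
  then show ?thesis using sin_pos cos_pos
    by (simp add: apex_def complex_eq_iff)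
qed

text \<open>An interior point of a triangle lies strictly within each half-plane that contains the corners.\<close>

lemma interior_region_halfplane:
  assumes z: "z \<in> interior (region (\<theta>, \<theta>))" and a: "a \<noteq> 0"
    and v: "0 \<le> b" "inner a 1 \<le> b" "inner a (apex (\<theta>, \<theta>)) \<le> b"
  shows "inner a z < b"
proof -
  have "region (\<theta>, \<theta>) \<subseteq> {w. inner a w \<le> b}"
    unfolding region_def by (rule hull_minimal) (use v convex_halfspace_le in auto)
  then have "interior (region (\<theta>, \<theta>)) \<subseteq> interior {w. inner a w \<le> b}" by (rule interior_mono)
  then show ?thesis using z interior_halfspace_le[OF a] by auto
qed

lemma interior_region:
  assumes "z \<in> interior (region (\<theta>, \<theta>))"
  shows "Im z > 0" "cos \<theta> * Im z < sin \<theta> * Re z" "cos \<theta> * Im z < sin \<theta> * (1 - Re z)"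
proof -
  note p = sin_pos cos_pos
  note i = inner_complex_def apex_isosceles
  have "inner (Complex 0 (-1)) z < 0"
    by (rule interior_region_halfplane[OF assms]) (use p in \<open>auto simp: i complex_eq_iff\<close>)
  then show "Im z > 0" by (simp add: i)
  have "inner (Complex (- sin \<theta>) (cos \<theta>)) z < 0"
    by (rule interior_region_halfplane[OF assms]) (use p in \<open>auto simp: i complex_eq_iff\<close>)
  then show "cos \<theta> * Im z < sin \<theta> * Re z" by (simp add: i)
  have "inner (Complex (sin \<theta>) (cos \<theta>)) z < sin \<theta>"
    by (rule interior_region_halfplane[OF assms]) (use p in \<open>auto simp: i complex_eq_iff\<close>)
  then show "cos \<theta> * Im z < sin \<theta> * (1 - Re z)" by (simp add: i algebra_simps)
qed

lemma on_edge1: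
  assumes "p \<in> edge_interior (\<theta>, \<theta>) Edge1"
  obtains r where "0 < r" "r < 1" "p = Complex (1 - r / 2) (r * (sin \<theta> / (2 * cos \<theta>)))"
proof -
  obtain r where r: "0 < r" "r < 1" "p = (1 - r) *\<^sub>R 1 + r *\<^sub>R apex (\<theta>, \<theta>)"
    using assms by (auto simp: edge_interior_def in_segment)
  then have "p = Complex (1 - r / 2) (r * (sin \<theta> / (2 * cos \<theta>)))"
    by (simp add: apex_isosceles complex_eq_iff)
  with r(1,2) show ?thesis by (rule that)
qed

lemma on_edge2:
  assumes "p \<in> edge_interior (\<theta>, \<theta>) Edge2"
  obtains r where "0 < r" "r < 1" "p = Complex (r / 2) (r * (sin \<theta> / (2 * cos \<theta>)))"
proof -
  obtain r where r: "0 < r" "r < 1" "p = (1 - r) *\<^sub>R 0 + r *\<^sub>R apex (\<theta>, \<theta>)"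
    using assms by (auto simp: edge_interior_def in_segment)
  then have "p = Complex (r / 2) (r * (sin \<theta> / (2 * cos \<theta>)))"
    by (simp add: apex_isosceles complex_eq_iff)
  with r(1,2) show ?thesis by (rule that)
qed

lemma on_edge3: "p \<in> edge_interior (\<theta>, \<theta>) Edge3 \<Longrightarrow> Im p = 0"
  by (auto simp: edge_interior_def in_segment)

lemma ratio_real_cis: "r \<noteq> 0 \<Longrightarrow> (of_real r * cis a) / cnj (of_real r * cis a) = cis (2 * a)"
  by (simp add: cis_cnj cis_divide)

lemma reflect_dir_isosceles:
  "reflect_dir (\<theta>, \<theta>) Edge1 v = cis (- 2 * \<theta>) * cnj v"
  "reflect_dir (\<theta>, \<theta>) Edge2 v = cis (2 * \<theta>) * cnj v"
  "reflect_dir (\<theta>, \<theta>) Edge3 v = cnj v"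
proof -
  note p = sin_pos cos_pos
  have 2: "apex (\<theta>, \<theta>) - 0 = of_real (1 / (2 * cos \<theta>)) * cis \<theta>"
    using p by (simp add: apex_isosceles complex_eq_iff)
  have 1: "apex (\<theta>, \<theta>) - 1 = of_real (- 1 / (2 * cos \<theta>)) * cis (- \<theta>)"
    using p by (simp add: apex_isosceles complex_eq_iff)
  show "reflect_dir (\<theta>, \<theta>) Edge1 v = cis (- 2 * \<theta>) * cnj v"
    using ratio_real_cis[of "- 1 / (2 * cos \<theta>)" "- \<theta>"] p
    unfolding reflect_dir_def edge_ends.simps prod.case 1 by simp
  show "reflect_dir (\<theta>, \<theta>) Edge2 v = cis (2 * \<theta>) * cnj v"
    using ratio_real_cis[of "1 / (2 * cos \<theta>)" "\<theta>"] p
    unfolding reflect_dir_def edge_ends.simps prod.case 2 by simp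
  show "reflect_dir (\<theta>, \<theta>) Edge3 v = cnj v" by (simp add: reflect_dir_def)
qed

end

lemma sg_Suc [simp]: "sg (Suc i) = - sg i" by (simp add: sg_def)

text \<open>A periodic trajectory as a sequence of segments: segment \<open>i\<close>
  starts in \<open>P i\<close> and has velocity \<open>V i\<close> and duration \<open>D i\<close>, where indices are read cyclically.\<close>

locale isosceles_path = isosceles +
  fixes k :: nat and c :: "nat \<Rightarrow> edge" and P V :: "nat \<Rightarrow> complex" and D :: "nat \<Rightarrow> real"
  assumes k: "k > 0" and c0: "c 0 = Edge3"
    and per: "c (i + k) = c i" "P (i + k) = P i" "V (i + k) = V i"
    and pos: "P i \<in> edge_interior (\<theta>, \<theta>) (c i)"
    and V0: "V i \<noteq> 0" and D: "D i > 0"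
    and nxt: "P (Suc i) = P i + D i *\<^sub>R V i"
    and mid: "P i + (D i / 2) *\<^sub>R V i \<in> interior (region (\<theta>, \<theta>))"
    and refl: "V (Suc i) = reflect_dir (\<theta>, \<theta>) (c (Suc i)) (V i)"
begin

primrec level :: "nat \<Rightarrow> int" where
  "level 0 = 0"
| "level (Suc i) = level i + turn i (c (Suc i))"

text \<open>In the lower half of the rhombus the path is reflected in the base, which changes the sign of
  the cross product.\<close>

definition offset :: "nat \<Rightarrow> real" where
  "offset i = sg i * Im (cnj (V i) * (P i - 1/2))"

definition lifted :: "nat \<Rightarrow> complex" where
  "lifted i = (if even i then V i else cnj (V i))"

definition dir :: "int \<Rightarrow> complex" where
  "dir m = cis (- 2 * \<theta> * of_int m) * V 0"

text \<open>The sides of the rhombus have length \<open>1 / (2 * cos \<theta>)\<close>, as its diagonal along the base has length 1.\<close>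

definition width :: "int \<Rightarrow> real" where
  "width m = Im (cis \<theta> * dir m) / (2 * cos \<theta>)"

lemma dir_add: "dir (m + l) = cis (- 2 * \<theta> * of_int l) * dir m"
  by (simp add: dir_def cis_mult[symmetric] distrib_left mult.assoc[symmetric] cis_mult add.commute)

lemma lifted_Suc: "lifted (Suc i) = cis (- 2 * \<theta> * of_int (turn i (c (Suc i)))) * lifted i"
  unfolding lifted_def refl
  by (cases "c (Suc i)") (auto simp: reflect_dir_isosceles cis_cnj)

text \<open>The direction in the frame of the rhombus depends on its number alone: every strike
  reflects the direction and changes the half of the rhombus. Together this is the identity for the base, and a rotation
  by \<open>2 * \<theta>\<close> or \<open>-2 * \<theta>\<close> for the other edges.\<close>

lemma lifted_dir: "lifted i = dir (level i)"
proof (induction i)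
  case (Suc i)
  then show ?case by (simp add: lifted_Suc dir_add)
qed (simp add: lifted_def dir_def)

lemma Re_dir: "Re (dir (level i)) = Re (V i)"
  by (simp add: lifted_dir[symmetric] lifted_def)

lemma Im_dir: "Im (dir (level i)) = sg i * Im (V i)"
  by (simp add: lifted_dir[symmetric] lifted_def sg_def)

lemma width_Suc: "width (m + 1) = Im (cis (- \<theta>) * dir m) / (2 * cos \<theta>)"
proof -
  have "cis \<theta> * cis (- 2 * \<theta>) = cis (- \<theta>)" by (simp add: cis_mult)
  then show ?thesis by (simp add: width_def dir_add mult.assoc[symmetric])
qed

text \<open>The sum of the vectors along two adjacent sides of the rhombus is its diagonal, the base of the triangle.\<close>

lemma width_sum: "width m + width (m + 1) = Im (dir m)"
  using cos_pos by (simp add: width_Suc) (simp add: width_def field_simps)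

lemma glide_width: "glide width d m = sgn (width (wall d m)) * (Im (dir (wall d m)) - Im (dir (wall d m - 1))) / 2"
  using width_sum[of "wall d m"] width_sum[of "wall d m - 1"] by (simp add: glide_def Let_def)

lemma widths:
  defines "A \<equiv> \<lambda>i. (cos \<theta> * Im (V i) - sin \<theta> * Re (V i)) / (2 * cos \<theta>)"
    and "B \<equiv> \<lambda>i. (cos \<theta> * Im (V i) + sin \<theta> * Re (V i)) / (2 * cos \<theta>)"
  shows "width (level i) = (if even i then B i else - A i)"
    "width (level i + 1) = (if even i then A i else - B i)"
  using cos_pos by (simp_all add: width_Suc) (simp_all add: width_def Re_dir Im_dir A_def B_def sg_def field_simps)

lemma offset_end: "offset i = sg i * Im (cnj (V i) * (P (Suc i) - 1/2))"
proof -
  have "Im (cnj (V i) * (P i + D i *\<^sub>R V i - 1/2)) = Im (cnj (V i) * (P i - 1/2))"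
    by (simp add: algebra_simps)
  then show ?thesis unfolding offset_def nxt by simp
qed

lemma offset_base:
  assumes "c (Suc i) = Edge3"
  shows "offset (Suc i) = offset i"
proof -
  have "Im (P (Suc i)) = 0" using pos[of "Suc i"] assms by (auto intro: on_edge3)
  moreover have "V (Suc i) = cnj (V i)" using refl assms by (simp add: reflect_dir_isosceles)
  ultimately show ?thesis unfolding offset_end[of i] offset_def[of "Suc i"]
    by simp
qed

lemma no_double_base:
  assumes "c (Suc i) = Edge3"
  shows "c (Suc (Suc i)) \<noteq> Edge3"
proof
  assume 2: "c (Suc (Suc i)) = Edge3"
  have 0: "Im (P (Suc i)) = 0" "Im (P (Suc (Suc i))) = 0"
    using pos[of "Suc i"] pos[of "Suc (Suc i)"] assms 2 by (auto intro: on_edge3)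
  have "0 < D (Suc i) / 2 * Im (V (Suc i))" using interior_region(1)[OF mid[of "Suc i"]] 0(1) by simp
  moreover have "D (Suc i) * Im (V (Suc i)) = 0" using nxt[of "Suc i"] 0 by simp
  ultimately show False by simp
qed

lemma strike_edge2:
  assumes "c (Suc i) = Edge2"
  shows "cos \<theta> * Im (V i) - sin \<theta> * Re (V i) > 0"
    and "\<exists>r. 0 < r \<and> r < 1 \<and> offset i = sg i * (Im (V i) / 2 -
           r * ((cos \<theta> * Im (V i) - sin \<theta> * Re (V i)) / (2 * cos \<theta>)))"
    and "offset (Suc i) = offset i - sg i * (Im (V i) + Im (V (Suc i))) / 2"
proof -
  obtain r where r: "0 < r" "r < 1" and p: "P (Suc i) = Complex (r / 2) (r * (sin \<theta> / (2 * cos \<theta>)))"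
    using pos[of "Suc i"] assms by (metis on_edge2)
  \<comment> \<open>The midpoint of the segment is inside the triangle, so the velocity points outwards at the strike.\<close>
  have m: "P i + (D i / 2) *\<^sub>R V i = P (Suc i) - (D i / 2) *\<^sub>R V i"
    unfolding nxt by (simp add: complex_eq_iff)
  have "cos \<theta> * (r * (sin \<theta> / (2 * cos \<theta>))) = sin \<theta> * (r / 2)" using cos_pos by simp
  moreover have "cos \<theta> * (Im (P (Suc i)) - D i / 2 * Im (V i)) < sin \<theta> * (Re (P (Suc i)) - D i / 2 * Re (V i))"
    using interior_region(2)[OF mid[of i]] unfolding m by simp
  ultimately have "0 < D i / 2 * (cos \<theta> * Im (V i) - sin \<theta> * Re (V i))"
    by (simp add: p algebra_simps)
  then show "cos \<theta> * Im (V i) - sin \<theta> * Re (V i) > 0" using D[of i] by (simp add: zero_less_mult_iff)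
  have "offset i = sg i * (Im (V i) / 2 -
           r * ((cos \<theta> * Im (V i) - sin \<theta> * Re (V i)) / (2 * cos \<theta>)))"
    unfolding offset_end p using cos_pos by (simp add: field_simps)
  then show "\<exists>r. 0 < r \<and> r < 1 \<and> offset i = sg i * (Im (V i) / 2 -
           r * ((cos \<theta> * Im (V i) - sin \<theta> * Re (V i)) / (2 * cos \<theta>)))" using r by blast
  have p': "P (Suc i) = of_real (r / (2 * cos \<theta>)) * cis \<theta>"
    unfolding p using cos_pos by (simp add: complex_eq_iff)
  have v: "V (Suc i) = cis (2 * \<theta>) * cnj (V i)" using refl assms by (simp add: reflect_dir_isosceles)
  have "cnj (V (Suc i)) * P (Suc i) = cnj (cnj (V i) * P (Suc i))"
  proof -
    have "cis (- (2 * \<theta>)) * cis \<theta> = cis (- \<theta>)" by (simp add: cis_mult)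
    then show ?thesis unfolding v p' by (simp add: cis_cnj mult.left_commute mult.commute)
  qed
  then have "Im (cnj (V (Suc i)) * P (Suc i)) = - Im (cnj (V i) * P (Suc i))" by simp
  then show "offset (Suc i) = offset i - sg i * (Im (V i) + Im (V (Suc i))) / 2"
  proof -
    assume h: "Im (cnj (V (Suc i)) * P (Suc i)) = - Im (cnj (V i) * P (Suc i))"
    have "offset i = sg i * (Im (cnj (V i) * P (Suc i)) + Im (V i) / 2)"
      unfolding offset_end by (simp add: algebra_simps)
    moreover have "offset (Suc i) = - sg i * (Im (cnj (V (Suc i)) * P (Suc i)) + Im (V (Suc i)) / 2)"
      unfolding offset_def by (simp add: algebra_simps)
    moreover have "- s * (- x + b / 2) = s * (x + a / 2) - s * (a + b) / 2" for s x a b :: real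
      by (simp add: field_simps)
    ultimately show ?thesis by (simp only: h)
  qed
qed

lemma strike_edge1:
  assumes "c (Suc i) = Edge1"
  shows "cos \<theta> * Im (V i) + sin \<theta> * Re (V i) > 0"
    and "\<exists>r. 0 < r \<and> r < 1 \<and> offset i = sg i * (
           r * ((cos \<theta> * Im (V i) + sin \<theta> * Re (V i)) / (2 * cos \<theta>)) - Im (V i) / 2)"
    and "offset (Suc i) = offset i + sg i * (Im (V i) + Im (V (Suc i))) / 2"
proof -
  obtain r where r: "0 < r" "r < 1" and p: "P (Suc i) = Complex (1 - r / 2) (r * (sin \<theta> / (2 * cos \<theta>)))"
    using pos[of "Suc i"] assms by (metis on_edge1)
  have m: "P i + (D i / 2) *\<^sub>R V i = P (Suc i) - (D i / 2) *\<^sub>R V i"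
    unfolding nxt by (simp add: complex_eq_iff)
  have "cos \<theta> * (r * (sin \<theta> / (2 * cos \<theta>))) = sin \<theta> * (r / 2)" using cos_pos by simp
  moreover have "cos \<theta> * (Im (P (Suc i)) - D i / 2 * Im (V i)) < sin \<theta> * (1 - (Re (P (Suc i)) - D i / 2 * Re (V i)))"
    using interior_region(3)[OF mid[of i]] unfolding m by simp
  ultimately have "0 < D i / 2 * (cos \<theta> * Im (V i) + sin \<theta> * Re (V i))"
    by (simp add: p algebra_simps)
  then show "cos \<theta> * Im (V i) + sin \<theta> * Re (V i) > 0" using D[of i] by (simp add: zero_less_mult_iff)
  have "offset i = sg i * (
           r * ((cos \<theta> * Im (V i) + sin \<theta> * Re (V i)) / (2 * cos \<theta>)) - Im (V i) / 2)"
    unfolding offset_end p using cos_pos by (simp add: field_simps)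
  then show "\<exists>r. 0 < r \<and> r < 1 \<and> offset i = sg i * (
           r * ((cos \<theta> * Im (V i) + sin \<theta> * Re (V i)) / (2 * cos \<theta>)) - Im (V i) / 2)" using r by blast
  \<comment> \<open>The vector from the corner of edge 1 on the base to the strike.\<close>
  define q where "q = of_real (- r / (2 * cos \<theta>)) * cis (- \<theta>)"
  have p': "P (Suc i) = 1 + q"
    unfolding p q_def using cos_pos by (simp add: complex_eq_iff)
  have v: "V (Suc i) = cis (- 2 * \<theta>) * cnj (V i)" using refl assms by (simp add: reflect_dir_isosceles)
  have "cnj (V (Suc i)) * q = cnj (cnj (V i) * q)"
  proof -
    have "cis (2 * \<theta>) * cis (- \<theta>) = cis \<theta>" by (simp add: cis_mult)
    then show ?thesis unfolding v q_def by (simp add: cis_cnj mult.left_commute mult.commute)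
  qed
  then have "Im (cnj (V (Suc i)) * q) = - Im (cnj (V i) * q)" by simp
  then show "offset (Suc i) = offset i + sg i * (Im (V i) + Im (V (Suc i))) / 2"
  proof -
    assume h: "Im (cnj (V (Suc i)) * q) = - Im (cnj (V i) * q)"
    have "offset i = sg i * (Im (cnj (V i) * q) - Im (V i) / 2)"
      unfolding offset_end p' by (simp add: algebra_simps)
    moreover have "offset (Suc i) = - sg i * (Im (cnj (V (Suc i)) * q) - Im (V (Suc i)) / 2)"
      unfolding offset_def p' by (simp add: algebra_simps)
    moreover have "- s * (- x - b / 2) = s * (x - a / 2) + s * (a + b) / 2" for s x a b :: real
      by (simp add: field_simps)
    ultimately show ?thesis by (simp only: h)
  qed
qed

lemma side_strike:
  assumes s: "c (Suc i) \<noteq> Edge3" and d: "d = turn i (c (Suc i))"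
  shows "sg i * width (wall d (level i)) > 0 \<and> window width d (level i) (offset i) \<and>
    offset (Suc i) = offset i + glide width d (level i)"
proof -
  define A where "A = (cos \<theta> * Im (V i) - sin \<theta> * Re (V i)) / (2 * cos \<theta>)"
  define B where "B = (cos \<theta> * Im (V i) + sin \<theta> * Re (V i)) / (2 * cos \<theta>)"
  have w: "width (level i) = (if even i then B else - A)" "width (level i + 1) = (if even i then A else - B)"
    using widths[of i] by (simp_all add: A_def B_def)
  have AB: "Im (V i) = A + B" using cos_pos by (simp add: A_def B_def field_simps)
  have lev: "level (Suc i) = level i + d" using d by simp
  have im: "Im (dir (level i)) = sg i * Im (V i)" "Im (dir (level i + d)) = - sg i * Im (V (Suc i))"
    using Im_dir[of i] Im_dir[of "Suc i"] lev by simp_all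
  have lin: "\<bar>r * y - y / 2\<bar> < y / 2" if "0 < r" "r < 1" "0 < y" for r y :: real
  proof -
    have "\<bar>r - 1/2\<bar> < 1/2" using that by linarith
    then have "\<bar>r - 1/2\<bar> * y < 1/2 * y" using that(3) by (rule mult_strict_right_mono)
    moreover have "r * y - y / 2 = (r - 1/2) * y" by (simp add: algebra_simps)
    ultimately show ?thesis using that(3) by (simp add: abs_mult)
  qed
  consider "c (Suc i) = Edge1" | "c (Suc i) = Edge2" using s by (cases "c (Suc i)") auto
  then show ?thesis
  proof cases
    case 1
    note E = strike_edge1[OF 1]
    have B: "B > 0" using E(1) cos_pos by (simp add: B_def)
    obtain r where r: "0 < r" "r < 1" "offset i = sg i * (r * B - (A + B) / 2)"
      using E(2) unfolding B_def[symmetric] AB[symmetric] by blast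
    have l: "\<bar>r * B - B / 2\<bar> < B / 2" using lin r B by blast
    show ?thesis
    proof (cases "even i")
      case True
      have d1: "d = -1" using d 1 True by simp
      have "offset i + A / 2 = r * B - B / 2" using r(3) True by (simp add: sg_def field_simps)
      then show ?thesis using B l E(3) True im
        by (simp add: d1 window_def wall_def w glide_width sg_def)
    next
      case False
      have d1: "d = 1" using d 1 False by simp
      have "offset i - A / 2 = - (r * B - B / 2)" using r(3) False by (simp add: sg_def field_simps)
      then have "\<bar>offset i - A / 2\<bar> < B / 2" using l by (simp only: abs_minus_cancel)
      then show ?thesis using B E(3) False im
        by (simp add: d1 window_def wall_def w glide_width sg_def)
    qed
  next
    case 2
    note E = strike_edge2[OF 2]
    have A: "A > 0" using E(1) cos_pos by (simp add: A_def)
    obtain r where r: "0 < r" "r < 1" "offset i = sg i * ((A + B) / 2 - r * A)"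
      using E(2) unfolding A_def[symmetric] AB[symmetric] by blast
    have l: "\<bar>r * A - A / 2\<bar> < A / 2" using lin r A by blast
    show ?thesis
    proof (cases "even i")
      case True
      have d1: "d = 1" using d 2 True by simp
      have "offset i - B / 2 = - (r * A - A / 2)" using r(3) True by (simp add: sg_def field_simps)
      then have "\<bar>offset i - B / 2\<bar> < A / 2" using l by (simp only: abs_minus_cancel)
      then show ?thesis using A E(3) True im
        by (simp add: d1 window_def wall_def w glide_width sg_def add_divide_distrib)
    next
      case False
      have d1: "d = -1" using d 2 False by simp
      have "offset i + B / 2 = r * A - A / 2" using r(3) False by (simp add: sg_def field_simps)
      then show ?thesis using A l E(3) False im
        by (simp add: d1 window_def wall_def w glide_width sg_def add_divide_distrib diff_divide_distrib)
    qed
  qed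
qed

lemma turn_period: "turn (i + 2 * k) a = turn i a"
  by (cases a) auto

lemma level_period: "level (i + 2 * k) = level i + level (2 * k)"
proof (induction i)
  case (Suc i)
  have "c (Suc i + 2 * k) = c (Suc i)" using per(1)[of "Suc i + k"] per(1)[of "Suc i"] by (simp add: mult_2 add.assoc)
  then show ?case using Suc turn_period[of i] by simp
qed simp

sublocale folded_path width k c level offset "level (2 * k)"
proof
  fix i
  show "offset (i + 2 * k) = offset i"
    using per(2,3)[of "i + k"] per(2,3)[of i] by (simp add: offset_def sg_def mult_2 add.assoc)
  show "c (Suc i) = Edge3 \<Longrightarrow> offset (Suc i) = offset i \<and> c (Suc (Suc i)) \<noteq> Edge3"
    using offset_base no_double_base by blast
qed (use k c0 per(1) level_period side_strike in auto)

lemma closing: "cis (2 * \<theta> * of_int (level (2 * k))) = 1"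
proof -
  have "V (2 * k) = V 0" using per(3)[of k] per(3)[of 0] by (simp add: mult_2)
  then have "dir (level (2 * k)) = V 0" by (simp add: lifted_dir[symmetric] lifted_def)
  then have "cis (- 2 * \<theta> * of_int (level (2 * k))) = 1" using V0[of 0] by (simp add: dir_def)
  then have "cnj (cis (- 2 * \<theta> * of_int (level (2 * k)))) = cnj 1" by simp
  then show ?thesis by (simp add: cis_cnj)
qed

lemma width_flip:
  assumes "cis (2 * \<theta> * of_int N) = -1"
  shows "width (j + N) = - width j"
proof -
  have "cnj (cis (2 * \<theta> * of_int N)) = cnj (-1)" using assms by simp
  then have "cis (- 2 * \<theta> * of_int N) = -1" by (simp add: cis_cnj)
  then have "dir (j + N) = - dir j" by (simp only: dir_add) simp
  then have "Im (cis \<theta> * dir (j + N)) = - Im (cis \<theta> * dir j)"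
    by (simp only: mult_minus_right uminus_complex.sel)
  then show ?thesis by (simp only: width_def minus_divide_left)
qed

text \<open>Over a period the direction returns, so the number of the rhombus changes by some \<open>l\<close> such that
  \<open>l * \<theta>\<close> is a multiple of \<open>\<pi>\<close>. If \<open>\<theta> = a * \<pi> / (2 * N)\<close> with \<open>a\<close> odd, then \<open>N\<close> steps turn the direction
  by an odd multiple of \<open>\<pi>\<close>, which is where the evenness of the denominator enters.\<close>

lemma irrational_or_even:
  assumes "\<theta> / pi \<notin> \<rat> \<or>
         (\<exists>a b :: int. b \<noteq> 0 \<and> gcd a b = 1 \<and> even b \<and> \<theta> = real_of_int a / real_of_int b * pi)"
  shows "level (2 * k) = 0 \<or> (\<exists>N. 2 * N dvd level (2 * k) \<and> (\<forall>j. width (j + N) = - width j))"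
proof -
  let ?l = "level (2 * k)"
  have "cos (2 * \<theta> * of_int ?l) = 1" using closing by (metis cis.sel(1) one_complex.sel(1))
  then obtain z :: int where z: "2 * \<theta> * of_int ?l = of_int z * 2 * pi"
    using cos_one_2pi_int by metis
  from assms show ?thesis
  proof
    assume irr: "\<theta> / pi \<notin> \<rat>"
    have "?l = 0"
    proof (rule ccontr)
      assume "?l \<noteq> 0"
      then have "\<theta> / pi = of_int z / of_int ?l" using z by (simp add: field_simps)
      then show False using irr by simp
    qed
    then show ?thesis by simp
  next
    assume "\<exists>a b :: int. b \<noteq> 0 \<and> gcd a b = 1 \<and> even b \<and> \<theta> = real_of_int a / real_of_int b * pi"
    then obtain a b :: int where ab: "b \<noteq> 0" "gcd a b = 1" "even b" "\<theta> = real_of_int a / real_of_int b * pi"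
      by (elim exE conjE) (rule that; assumption)
    obtain N where N: "b = 2 * N" using ab(3) by blast
    have "of_int (a * ?l) = (of_int (b * z) :: real)"
      using z ab(1,4) by (simp add: field_simps)
    then have "a * ?l = b * z" by (simp only: of_int_eq_iff)
    then have "b dvd a * ?l" by simp
    moreover have "coprime b a" using ab(2) by (simp add: coprime_iff_gcd_eq_1 gcd.commute)
    ultimately have "b dvd ?l" using coprime_dvd_mult_right_iff by blast
    have "odd a"
    proof
      assume "even a"
      then have "2 dvd gcd a b" using ab(3) by (rule gcd_greatest)
      then show False using ab(2) by simp
    qed
    then obtain l where l: "a = 2 * l + 1" by (rule oddE)
    have "2 * \<theta> * of_int N = of_int a * pi" using ab(1,4) N by (simp add: field_simps)
    also have "\<dots> = pi + of_int l * (2 * pi)" by (simp add: l algebra_simps)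
    finally have "cis (2 * \<theta> * of_int N) = cis pi * cis (of_int l * (2 * pi))" by (simp only: cis_mult)
    also have "\<dots> = -1" using cis_multiple_2pi[of "of_int l"] by (simp add: mult.commute mult.left_commute)
    finally show ?thesis using width_flip \<open>b dvd ?l\<close> N by blast
  qed
qed

end

lemma isosceles_path_of_trajectory:
  assumes T: "(\<theta>, \<theta>) \<in> triangles" and traj: "periodic_trajectory (\<theta>, \<theta>) f C" and C0: "C ! 0 = Edge3"
  shows "\<exists>P V D. isosceles_path \<theta> (length C) (\<lambda>i. C ! (i mod length C)) P V D"
proof -
  define k where "k = length C"
  obtain t v where k0: "k > 0" and t0: "t 0 = (0::real)" and tk: "t k = 1" and f1: "f 1 = f 0"
    and P: "\<And>i. i < k \<Longrightarrow> t i < t (Suc i) \<and> f (t i) \<in> edge_interior (\<theta>, \<theta>) (C ! i) \<and> v i \<noteq> 0 \<and>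
                 (\<forall>s\<in>{t i..t (Suc i)}. f s = f (t i) + (s - t i) *\<^sub>R v i) \<and>
                 (\<forall>s\<in>{t i<..<t (Suc i)}. f s \<in> interior (region (\<theta>, \<theta>))) \<and>
                 v (Suc i mod k) = reflect_dir (\<theta>, \<theta>) (C ! (Suc i mod k)) (v i)"
    using traj unfolding periodic_trajectory_def k_def[symmetric] Let_def by blast
  have P1: "t i < t (Suc i)" "f (t i) \<in> edge_interior (\<theta>, \<theta>) (C ! i)" "v i \<noteq> 0"
    "v (Suc i mod k) = reflect_dir (\<theta>, \<theta>) (C ! (Suc i mod k)) (v i)" if "i < k" for i
    using P[OF that] by blast+
  have lin: "f (t i + s * (t (Suc i) - t i)) = f (t i) + (s * (t (Suc i) - t i)) *\<^sub>R v i"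
    if "i < k" "0 \<le> s" "s \<le> 1" for i s
  proof -
    have "s * (t (Suc i) - t i) \<le> 1 * (t (Suc i) - t i)" "0 \<le> s * (t (Suc i) - t i)"
      using that P1(1)[OF that(1)] by (auto intro: mult_right_mono)
    then have "t i + s * (t (Suc i) - t i) \<in> {t i..t (Suc i)}" by simp
    then have "f (t i + s * (t (Suc i) - t i)) = f (t i) + (t i + s * (t (Suc i) - t i) - t i) *\<^sub>R v i"
      using P[OF that(1)] by blast
    then show ?thesis by simp
  qed
  have nxt: "f (t (Suc i mod k)) = f (t i) + (t (Suc i) - t i) *\<^sub>R v i" if i: "i < k" for i
  proof -
    have "f (t (Suc i mod k)) = f (t (Suc i))"
    proof (cases "Suc i = k")
      case True then show ?thesis using f1 t0 tk by simp
    next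
      case False then show ?thesis using i by simp
    qed
    then show ?thesis using lin[OF i, of 1] by simp
  qed
  have mid: "f (t i) + ((t (Suc i) - t i) / 2) *\<^sub>R v i \<in> interior (region (\<theta>, \<theta>))" if i: "i < k" for i
  proof -
    have "t i + 1/2 * (t (Suc i) - t i) \<in> {t i<..<t (Suc i)}" using P1(1)[OF i] by (simp add: field_simps)
    then have "f (t i + 1/2 * (t (Suc i) - t i)) \<in> interior (region (\<theta>, \<theta>))" using P[OF i] by blast
    then show ?thesis using lin[OF i, of "1/2"] by simp
  qed
  have "isosceles_path \<theta> k (\<lambda>i. C ! (i mod k)) (\<lambda>i. f (t (i mod k))) (\<lambda>i. v (i mod k))
     (\<lambda>i. t (Suc (i mod k)) - t (i mod k))"
  proof
    show "0 < \<theta>" "\<theta> < pi / 2" using T by (auto simp: triangles_def)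
    fix i
    have ik: "i mod k < k" using k0 by simp
    have m: "Suc i mod k = Suc (i mod k) mod k" by (simp add: mod_Suc_eq)
    show "f (t (Suc i mod k)) = f (t (i mod k)) + (t (Suc (i mod k)) - t (i mod k)) *\<^sub>R v (i mod k)"
      unfolding m by (rule nxt[OF ik])
    show "f (t (i mod k)) + ((t (Suc (i mod k)) - t (i mod k)) / 2) *\<^sub>R v (i mod k) \<in> interior (region (\<theta>, \<theta>))"
      by (rule mid[OF ik])
    show "v (Suc i mod k) = reflect_dir (\<theta>, \<theta>) (C ! (Suc i mod k)) (v (i mod k))"
      unfolding m by (rule P1(4)[OF ik])
    show "0 < t (Suc (i mod k)) - t (i mod k)" using P1(1)[OF ik] by simp
    show "f (t (i mod k)) \<in> edge_interior (\<theta>, \<theta>) (C ! (i mod k))" by (rule P1(2)[OF ik])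
    show "v (i mod k) \<noteq> 0" by (rule P1(3)[OF ik])
  qed (use k0 C0 in auto)
  then show ?thesis unfolding k_def by blast
qed

section \<open>Words up to rotation and reversal\<close>

definition cyclic :: "'a list \<Rightarrow> 'a list \<Rightarrow> bool" where
  "cyclic X Y \<longleftrightarrow> (\<exists>p q. rotate p X = rotate q Y)"

lemma cyclic_refl: "cyclic X X"
  by (auto simp: cyclic_def)

lemma cyclic_sym: "cyclic X Y \<Longrightarrow> cyclic Y X"
  by (metis cyclic_def)

lemma cyclic_trans: "cyclic X Y \<Longrightarrow> cyclic Y Z \<Longrightarrow> cyclic X Z"
  unfolding cyclic_def by (metis rotate_rotate add.commute)

lemma cyclic_map: "cyclic X Y \<Longrightarrow> cyclic (map g X) (map g Y)"
  unfolding cyclic_def by (metis rotate_map)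

lemma rotate_rev_rotate: "rotate p (rev (rotate p X)) = rev X"
proof (induction p)
  case (Suc p)
  have 1: "rotate1 (rev (rotate1 Y)) = rev Y" for Y :: "'a list"
    by (cases Y) auto
  have "rotate (Suc p) (rev (rotate (Suc p) X)) = rotate p (rotate1 (rev (rotate1 (rotate p X))))"
    by (simp add: rotate1_rotate_swap)
  then show ?case using Suc 1 by metis
qed simp

lemma cyclic_rev: "cyclic X Y \<Longrightarrow> cyclic (rev X) (rev Y)"
proof -
  have r: "cyclic (rev X) (rev (rotate p X))" for p and X :: "'a list"
    unfolding cyclic_def by (metis rotate_rev_rotate rotate0 id_apply)
  assume "cyclic X Y"
  then obtain p q where "rotate p X = rotate q Y" by (auto simp: cyclic_def)
  then show ?thesis using r[of X p] r[of Y q] by (metis cyclic_sym cyclic_trans)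
qed

lemma cyclic_rotate: "cyclic X Y \<Longrightarrow> \<exists>m. Y = rotate m X"
proof -
  assume "cyclic X Y"
  then obtain p q where pq: "rotate p X = rotate q Y" by (auto simp: cyclic_def)
  have "\<exists>r. rotate r (rotate q Y) = Y"
  proof (cases "Y = []")
    case False
    then have "q \<le> length Y * q" by (cases Y) auto
    then have "rotate (length Y * q - q) (rotate q Y) = rotate (length Y * q) Y"
      by (simp add: rotate_rotate)
    also have "\<dots> = Y" by (subst rotate_conv_mod) simp
    finally show ?thesis by blast
  qed simp
  then show ?thesis using pq by (metis rotate_rotate)
qed

definition dihedral :: "'a list \<Rightarrow> 'a list \<Rightarrow> bool" where
  "dihedral X Y \<longleftrightarrow> cyclic X Y \<or> cyclic X (rev Y)"

lemma dihedral_sym: "dihedral X Y \<Longrightarrow> dihedral Y X"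
  unfolding dihedral_def using cyclic_rev[of X "rev Y"] by (metis cyclic_sym rev_rev_ident)

lemma dihedral_trans: "dihedral X Y \<Longrightarrow> dihedral Y Z \<Longrightarrow> dihedral X Z"
  unfolding dihedral_def using cyclic_rev[of Y Z] cyclic_rev[of Y "rev Z"]
  by (metis cyclic_trans rev_rev_ident)

lemma dihedral_map: "dihedral X Y \<Longrightarrow> dihedral (map g X) (map g Y)"
  unfolding dihedral_def using cyclic_map[of X Y g] cyclic_map[of X "rev Y" g] by (auto simp: rev_map)

lemma cyclic_reverse_type: "cyclic (reverse_type C) (rev C)"
proof (cases C)
  case (Cons a es)
  then have "rotate 1 (reverse_type C) = rotate 0 (rev C)" by simp
  then show ?thesis unfolding cyclic_def by blast
qed (simp add: cyclic_refl)

lemma equivalent_dihedral: "equivalent_types C D \<Longrightarrow> dihedral D C"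
  unfolding equivalent_types_def dihedral_def using cyclic_refl cyclic_reverse_type by auto

lemma dihedral_equivalent:
  assumes "dihedral W C"
  shows "\<exists>D. equivalent_types C D \<and> cyclic W D"
  using assms cyclic_trans[OF _ cyclic_sym[OF cyclic_reverse_type]]
  unfolding dihedral_def equivalent_types_def by metis

lemma equivalent_types_first: "equivalent_types C D \<Longrightarrow> (C = [] \<longleftrightarrow> D = []) \<and> (C \<noteq> [] \<longrightarrow> D ! 0 = C ! 0)"
  unfolding equivalent_types_def by (cases C) auto

text \<open>A trajectory whose word is a rotation of \<open>D\<close> can be started at another strike so that its word
  is \<open>D\<close>. A tile admits the reversed word by definition.\<close>

lemma orbit_tileI:
  assumes "T \<in> triangles" "periodic_trajectory T f W" "dihedral W C" "C \<noteq> []" "C ! 0 = Edge3"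
  shows "T \<in> orbit_tile C"
proof -
  obtain D where D: "equivalent_types C D" "cyclic W D" using dihedral_equivalent assms by blast
  obtain m where "D = rotate m W" using cyclic_rotate[OF D(2)] by blast
  then obtain f' where f': "periodic_trajectory T f' D" using periodic_rotate[OF assms(2)] by blast
  have "D ! 0 = Edge3" using equivalent_types_first[OF D(1)] assms by simp
  then have "from_base T f'" using periodic_start[OF f'] by (simp add: from_base_def)
  then show ?thesis using assms(1) f' D(1) by (auto simp: orbit_tile_def)
qed

lemma isosceles_word_symmetric:
  assumes T: "(\<theta>, \<theta>) \<in> triangles" and traj: "periodic_trajectory (\<theta>, \<theta>) f D" and D0: "D ! 0 = Edge3"
    and angle: "\<theta> / pi \<notin> \<rat> \<or>
         (\<exists>a b :: int. b \<noteq> 0 \<and> gcd a b = 1 \<and> even b \<and> \<theta> = real_of_int a / real_of_int b * pi)"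
  shows "dihedral (map swap_edge D) D"
proof -
  define k where "k = length D"
  obtain P V L where "isosceles_path \<theta> k (\<lambda>i. D ! (i mod k)) P V L"
    using isosceles_path_of_trajectory[OF T traj D0] unfolding k_def by blast
  then interpret isosceles_path \<theta> k "\<lambda>i. D ! (i mod k)" P V L .
  have len: "length (rotate p D) = k" for p by (simp add: k_def)
  have nth: "rotate p D ! m = D ! ((p + m) mod k)" if "m < k" for p m
    using that by (simp add: nth_rotate k_def)
  from word_symmetry[OF irrational_or_even[OF angle]] show ?thesis
  proof
    assume "\<exists>p q. \<forall>m<k. D ! ((p + m) mod k) = swap_edge (D ! ((q + (k - 1 - m)) mod k))"
    then obtain p q where pq: "\<And>m. m < k \<Longrightarrow> D ! ((p + m) mod k) = swap_edge (D ! ((q + (k - 1 - m)) mod k))"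
      by blast
    have "rotate p D = map swap_edge (rev (rotate q D))"
    proof (rule nth_equalityI)
      fix m assume "m < length (rotate p D)"
      then have m: "m < k" by (simp add: k_def)
      then have "k - 1 - m < k" by simp
      moreover have "rev (rotate q D) ! m = rotate q D ! (k - 1 - m)"
        using m len[of q] by (simp add: rev_nth)
      ultimately show "rotate p D ! m = map swap_edge (rev (rotate q D)) ! m"
        using m pq[OF m] nth len by simp
    qed simp
    then have "rev (rotate p D) = map swap_edge (rotate q D)" by (simp add: rev_map[symmetric])
    then have "rev (rotate p D) = rotate q (map swap_edge D)" by (simp add: rotate_map)
    moreover have "cyclic (rev (rotate p D)) (rev D)"
      unfolding cyclic_def by (metis rotate_rev_rotate rotate0 id_apply)
    ultimately have "cyclic (rotate q (map swap_edge D)) (rev D)" by simp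
    moreover have "cyclic (map swap_edge D) (rotate q (map swap_edge D))"
      unfolding cyclic_def by (metis rotate0 id_apply)
    ultimately show ?thesis unfolding dihedral_def using cyclic_trans by blast
  next
    assume "\<exists>p q. \<forall>l. D ! ((p + l) mod k) = swap_edge (D ! ((q + l) mod k))"
    then obtain p q where pq: "\<And>l. D ! ((p + l) mod k) = swap_edge (D ! ((q + l) mod k))" by blast
    have "rotate p D = map swap_edge (rotate q D)"
      by (rule nth_equalityI) (use pq nth len in \<open>simp_all\<close>)
    then have "rotate p D = rotate q (map swap_edge D)" by (simp add: rotate_map)
    then show ?thesis unfolding dihedral_def cyclic_def by metis
  qed
qed

theorem corollary1p6:
  fixes C :: "edge list" and \<theta> :: real
  assumes "(\<theta>, \<theta>) \<in> orbit_tile C"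
    and "\<theta> / pi \<notin> \<rat> \<or>
         (\<exists>a b :: int. b \<noteq> 0 \<and> gcd a b = 1 \<and> even b \<and> \<theta> = real_of_int a / real_of_int b * pi)"
  shows "\<forall>\<theta>1 \<theta>2. (\<theta>1, \<theta>2) \<in> orbit_tile C \<longleftrightarrow> (\<theta>2, \<theta>1) \<in> orbit_tile C"
proof -
  obtain f D where T: "(\<theta>, \<theta>) \<in> triangles" and f: "from_base (\<theta>, \<theta>) f" "periodic_trajectory (\<theta>, \<theta>) f D"
    and D: "equivalent_types C D"
    using assms(1) by (auto simp: orbit_tile_def)
  interpret isosceles \<theta> using T by unfold_locales (auto simp: triangles_def)
  have start: "D \<noteq> []" "f 0 \<in> edge_interior (\<theta>, \<theta>) (D ! 0)" using periodic_start[OF f(2)] by auto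
  have im: "Im (f 0) = 0" using f(1) on_edge3 by (simp add: from_base_def)
  have D0: "D ! 0 = Edge3"
  proof (cases "D ! 0")
    case Edge1
    then show ?thesis using start(2) im sin_pos cos_pos by (auto elim!: on_edge1)
  next
    case Edge2
    then show ?thesis using start(2) im sin_pos cos_pos by (auto elim!: on_edge2)
  qed
  have C: "C \<noteq> []" "C ! 0 = Edge3" using equivalent_types_first[OF D] start(1) D0 by auto
  have DC: "dihedral D C" using equivalent_dihedral[OF D] .
  have "dihedral (map swap_edge D) D" by (rule isosceles_word_symmetric[OF T f(2) D0 assms(2)])
  then have swap: "dihedral (map swap_edge C) C"
    using DC by (metis dihedral_map dihedral_sym dihedral_trans)
  have "(\<theta>2, \<theta>1) \<in> orbit_tile C" if "(\<theta>1, \<theta>2) \<in> orbit_tile C" for \<theta>1 \<theta>2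
  proof -
    obtain g E where T12: "(\<theta>1, \<theta>2) \<in> triangles" and g: "periodic_trajectory (\<theta>1, \<theta>2) g E"
      and E: "equivalent_types C E"
      using \<open>(\<theta>1, \<theta>2) \<in> orbit_tile C\<close> by (auto simp: orbit_tile_def)
    have "dihedral (map swap_edge E) C"
      using dihedral_trans[OF dihedral_map[OF equivalent_dihedral[OF E]] swap] .
    moreover have "(\<theta>2, \<theta>1) \<in> triangles" using T12 by (auto simp: triangles_def)
    ultimately show ?thesis using orbit_tileI periodic_swap[OF T12 g] C by blast
  qed
  then show ?thesis by blast
qed

end
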